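(* Consider the base model together with $\mathbf{RandEdge}$ queries, where $n$ is unknown to the algorithm, and let $\varepsilon\in(0,1)$. (a) There is a randomized algorithm that outputs a $(1+\varepsilon)$-approximation to $d$ using $\widetilde{O}\left(\varepsilon^{-2}\min\left(d, \sqrt{n/d}\right)\right)$ queries. In particular, it outputs a $(1+\varepsilon)$-approximation to $d$ using $\widetilde{O}\left(\varepsilon^{-2}n^{1/3}\right)$ queries. (b) Any algorithm that outputs a constant factor approximation to $d$ with $n$ unknown requires $\Omega(n^{1/3})$ queries. This holds even in the full adjacency model with random edge samples.
   Context: $G=(V,E)$ is an unknown simple undirected graph with $n=|V|$ vertices and $m=|E|$ edges, no isolated vertices, and average degree $d=2m/n$. Access to $G$ is only through oracles, each of unit cost: - $\mathbf{RandVert}()$ returns a uniformly random vertex. - $\mathbf{RandNbr}(x)$ returns a uniformly random neighbor of $x$. - $\mathbf{Degree}(x)$ returns $\deg(x)$. - $\mathbf{RandEdge}()$ returns a uniformly random edge. - $\mathbf{FullNbrHood}(x)$ returns the full adjacency list of $x$. The base model gives $\mathbf{RandVert}$, $\mathbf{RandNbr}$ and $\mathbf{Degree}$. The full adjacency model additionally gives $\mathbf{FullNbrHood}$ (and hence also $\mathbf{Pair}$ and $\mathbf{Additive}$-type information). "$n$ unknown" means the algorithm is not given $n$; vertex identifiers come from a universe larger than any possible number of vertices and reveal no information about $n$. A $(1+\varepsilon)$-approximation to $d$ is a value in $[(1-\varepsilon)d,(1+\varepsilon)d]$. A constant factor approximation is a value in $[d/c,cd]$ for a constant $c$. Randomized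 guarantees hold with probability at least $0.99$. $\widetilde{O}$ hides factors polylogarithmic in $n$. *)

theory Defs
  imports "HOL-Probability.Probability_Mass_Function"
begin

section \<open>Graphs\<close>

text \<open>
  Vertex identifiers are natural numbers and the vertex set may be any finite set of them, so that
  the universe of identifiers is infinite and an identifier carries no information about the number
  of vertices.  An edge is the two-element set of its endpoints.
\<close>

record graph =
  verts :: "nat set"
  edges :: "nat set set"

definition nbrs :: "graph \<Rightarrow> nat \<Rightarrow> nat set" where
  "nbrs G x = {y. {x, y} \<in> edges G}"

definition deg :: "graph \<Rightarrow> nat \<Rightarrow> nat" where
  "deg G x = card (nbrs G x)"

definition simple_graph :: "graph \<Rightarrow> bool" where
  "simple_graph G \<longleftrightarrow> finite (verts G) \<and> verts G \<noteq> {} \<and>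
     (\<forall>e\<in>edges G. \<exists>u\<in>verts G. \<exists>v\<in>verts G. u \<noteq> v \<and> e = {u, v})"

definition no_isolated :: "graph \<Rightarrow> bool" where
  "no_isolated G \<longleftrightarrow> (\<forall>x\<in>verts G. deg G x > 0)"

definition input_graph :: "graph \<Rightarrow> bool" where
  "input_graph G \<longleftrightarrow> simple_graph G \<and> no_isolated G"

definition num_verts :: "graph \<Rightarrow> nat" where
  "num_verts G = card (verts G)"

definition num_edges :: "graph \<Rightarrow> nat" where
  "num_edges G = card (edges G)"

definition avg_deg :: "graph \<Rightarrow> real" where
  "avg_deg G = 2 * real (num_edges G) / real (num_verts G)"


section \<open>Oracles\<close>

datatype oracle_query = RandVert | RandNbr nat | Degree nat | RandEdge | FullNbrHood nat

datatype answer = Vertex nat | Number nat | Edge "nat set" | Nbrs "nat set" | Invalid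

text \<open>
  An algorithm may query any identifier; one that is not a vertex is answered by \<open>Invalid\<close>.
\<close>

primrec answer_pmf :: "graph \<Rightarrow> oracle_query \<Rightarrow> answer pmf" where
  "answer_pmf G RandVert = map_pmf Vertex (pmf_of_set (verts G))"
| "answer_pmf G (RandNbr x) =
     (if x \<in> verts G then map_pmf Vertex (pmf_of_set (nbrs G x)) else return_pmf Invalid)"
| "answer_pmf G (Degree x) =
     return_pmf (if x \<in> verts G then Number (deg G x) else Invalid)"
| "answer_pmf G RandEdge = map_pmf Edge (pmf_of_set (edges G))"
| "answer_pmf G (FullNbrHood x) =
     return_pmf (if x \<in> verts G then Nbrs (nbrs G x) else Invalid)"

definition base_model :: "oracle_query set" where
  "base_model = {RandVert} \<union> range RandNbr \<union> range Degree"

definition full_adjacency_model :: "oracle_query set" where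
  "full_adjacency_model = base_model \<union> range FullNbrHood"


section \<open>Randomized query algorithms\<close>

datatype action = Ask oracle_query | Return real

type_synonym history = "(oracle_query \<times> answer) list"

text \<open>
  A randomized algorithm chooses its next action at random, depending on the queries made and the
  answers received so far.  The graph is not an argument, so all that the algorithm learns about it,
  including the number of vertices, comes from the answers.
\<close>

type_synonym algorithm = "history \<Rightarrow> action pmf"

definition uses_only :: "oracle_query set \<Rightarrow> algorithm \<Rightarrow> bool" where
  "uses_only Q A \<longleftrightarrow> (\<forall>h q. Ask q \<in> set_pmf (A h) \<longrightarrow> q \<in> Q)"

text \<open>
  \<open>run A G t h\<close> is the distribution of the result of \<open>A\<close> on \<open>G\<close> from history \<open>h\<close> on, when \<open>A\<close> is
  cut off after \<open>t\<close> further queries: \<open>Some r\<close> if it has returned \<open>r\<close> after at most \<open>t\<close> queries,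
  and \<open>None\<close> if it asks for one more.
\<close>

primrec run :: "algorithm \<Rightarrow> graph \<Rightarrow> nat \<Rightarrow> history \<Rightarrow> real option pmf" where
  "run A G 0 h = bind_pmf (A h) (\<lambda>a. case a of
       Return r \<Rightarrow> return_pmf (Some r)
     | Ask q \<Rightarrow> return_pmf None)"
| "run A G (Suc t) h = bind_pmf (A h) (\<lambda>a. case a of
       Return r \<Rightarrow> return_pmf (Some r)
     | Ask q \<Rightarrow> bind_pmf (answer_pmf G q) (\<lambda>y. run A G t (h @ [(q, y)])))"

definition prob_within :: "algorithm \<Rightarrow> graph \<Rightarrow> real set \<Rightarrow> nat \<Rightarrow> real" where
  "prob_within A G S t = measure_pmf.prob (run A G t []) (Some ` S)"

text \<open>
  With probability at least 0.99, \<open>A\<close> returns an element of \<open>S\<close>, with no bound on the number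
  of queries.  The probabilities are increasing in \<open>t\<close>, so the supremum is their limit.
\<close>

definition outputs_in :: "algorithm \<Rightarrow> graph \<Rightarrow> real set \<Rightarrow> bool" where
  "outputs_in A G S \<longleftrightarrow> (SUP t. prob_within A G S t) \<ge> 99 / 100"

text \<open>
  With probability at least 0.99, \<open>A\<close> returns an element of \<open>S\<close> after at most \<open>q\<close> queries.
  For \<open>S = UNIV\<close> this says that the query bound \<open>q\<close> holds with probability at least 0.99.
\<close>

definition outputs_in_using :: "algorithm \<Rightarrow> graph \<Rightarrow> real set \<Rightarrow> real \<Rightarrow> bool" where
  "outputs_in_using A G S q \<longleftrightarrow> (\<exists>t::nat. real t \<le> q \<and> prob_within A G S t \<ge> 99 / 100)"


section \<open>Approximations of the average degree\<close>

definition eps_approx :: "real \<Rightarrow> graph \<Rightarrow> real set" where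
  "eps_approx \<epsilon> G = {(1 - \<epsilon>) * avg_deg G .. (1 + \<epsilon>) * avg_deg G}"

definition factor_approx :: "real \<Rightarrow> graph \<Rightarrow> real set" where
  "factor_approx c G = {avg_deg G / c .. c * avg_deg G}"

end

theory Submission
  imports Defs
begin

text \<open>
  Upper bound.  For every function \<open>g\<close> the average degree is the quotient of the mean of
  \<open>deg x * g (deg x)\<close> over random vertices by the mean of \<open>g (deg x)\<close> over the ends of random edges.
  Taking \<open>g = 1 / deg\<close> estimates \<open>1 / d\<close> from \<open>O(d / \<epsilon>\<^sup>2)\<close> edges.  Taking for \<open>g\<close> the indicator of
  \<open>deg \<le> \<theta>\<close> needs \<open>O(\<theta> / (d \<epsilon>\<^sup>2))\<close> vertices, provided that a constant fraction of the edge ends has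
  degree at most \<open>\<theta>\<close>.  The smallest degree seen among constantly many random edges is such a \<open>\<theta>\<close>, and
  it is at most \<open>4 * sqrt m\<close>, because few edges join two vertices of larger degree; so
  \<open>\<theta> / d = O(sqrt (n / d))\<close>.  Both estimators draw samples until a fixed sum is reached.  They run in
  parallel and the first to stop gives the output, so the cheaper one is used although neither \<open>n\<close> nor
  \<open>d\<close> is known.

  Lower bound.  Take a clique on about \<open>n powr (2 / 3)\<close> vertices together with a perfect matching on the
  remaining vertices, and the same clique with a matching that is larger by a constant factor.  A random
  vertex lies in the clique, and a random edge in the matching, with probability \<open>O(n powr (- 1 / 3))\<close>.
  When the identifiers of the matching are random in a huge range, both graphs thus answer fewer than
  \<open>\<kappa> * n powr (1 / 3)\<close> queries like one ideal process, in which a random vertex is always a fresh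
  matching vertex, a random edge is always a clique edge, and a guessed identifier is always invalid.
\<close>

section \<open>Independent samples\<close>

lemma measure_bind_pmf:
  "measure_pmf.prob (bind_pmf p f) X = measure_pmf.expectation p (\<lambda>x. measure_pmf.prob (f x) X)"
proof -
  have "ennreal (measure_pmf.prob (bind_pmf p f) X) = (\<integral>\<^sup>+x. ennreal (measure_pmf.prob (f x) X) \<partial>p)"
    by (simp add: measure_pmf.emeasure_eq_measure[symmetric])
  also have "\<dots> = ennreal (measure_pmf.expectation p (\<lambda>x. measure_pmf.prob (f x) X))"
    by (intro nn_integral_eq_integral measure_pmf.integrable_const_bound[where B = 1]) auto
  finally show ?thesis
    by (simp add: integral_nonneg_AE)
qed

lemma integrable_prob: "integrable (measure_pmf p) (\<lambda>x. measure_pmf.prob (f x) X)"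
  by (intro measure_pmf.integrable_const_bound[where B = 1]) auto

text \<open>Finite support makes every real function integrable, so conditioning on the first stage
  requires no bound on \<open>h\<close>.\<close>

lemma expectation_bind_pmf_finite:
  fixes h :: "'b \<Rightarrow> real"
  assumes "finite (set_pmf p)" "\<And>x. x \<in> set_pmf p \<Longrightarrow> finite (set_pmf (f x))"
  shows "measure_pmf.expectation (bind_pmf p f) h =
    measure_pmf.expectation p (\<lambda>x. measure_pmf.expectation (f x) h)"
  using pmf_expectation_bind[OF assms order.refl, where h = h]
    integral_measure_pmf[OF assms(1), of p "\<lambda>x. measure_pmf.expectation (f x) h"] by simp

lemma finite_set_replicate_pmf:
  "finite (set_pmf p) \<Longrightarrow> finite (set_pmf (replicate_pmf n p))"
  by (induction n) auto

lemma expectation_replicate_pmf_Suc: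
  fixes h :: "'a list \<Rightarrow> real"
  assumes "finite (set_pmf p)"
  shows "measure_pmf.expectation (replicate_pmf (Suc n) p) h =
    measure_pmf.expectation p (\<lambda>x. measure_pmf.expectation (replicate_pmf n p) (\<lambda>xs. h (x # xs)))"
  using assms by (simp add: expectation_bind_pmf_finite finite_set_replicate_pmf)

context
  fixes p :: "'a pmf" and f :: "'a \<Rightarrow> real" and \<mu> :: real
  assumes fin: "finite (set_pmf p)"
  defines "\<mu> \<equiv> measure_pmf.expectation p f"
begin

lemma expectation_sum_replicate_pmf:
  "measure_pmf.expectation (replicate_pmf n p) (\<lambda>xs. \<Sum>x\<leftarrow>xs. f x) = real n * \<mu>"
proof (induction n)
  case (Suc n)
  note [simp] = integrable_measure_pmf_finite[OF fin]
    integrable_measure_pmf_finite[OF finite_set_replicate_pmf[OF fin]]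
  show ?case
    by (simp add: expectation_replicate_pmf_Suc[OF fin] Suc del: replicate_pmf.simps)
       (simp add: \<mu>_def algebra_simps)
qed simp

lemma variance_sum_replicate_pmf:
  "measure_pmf.expectation (replicate_pmf n p) (\<lambda>xs. ((\<Sum>x\<leftarrow>xs. f x) - real n * \<mu>)\<^sup>2) =
    real n * measure_pmf.variance p f"
proof (induction n)
  case (Suc n)
  note [simp] = integrable_measure_pmf_finite[OF fin]
    integrable_measure_pmf_finite[OF finite_set_replicate_pmf[OF fin]]
  let ?E = "measure_pmf.expectation (replicate_pmf n p)"
  let ?D = "\<lambda>xs. (\<Sum>x\<leftarrow>xs. f x) - real n * \<mu>"
  have "?E (\<lambda>xs. ((\<Sum>x\<leftarrow>x # xs. f x) - real (Suc n) * \<mu>)\<^sup>2) =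
      (f x - \<mu>)\<^sup>2 + real n * measure_pmf.variance p f" for x
  proof -
    have "?E (\<lambda>xs. ((\<Sum>x\<leftarrow>x # xs. f x) - real (Suc n) * \<mu>)\<^sup>2) =
        ?E (\<lambda>xs. (f x - \<mu>)\<^sup>2 + 2 * (f x - \<mu>) * ?D xs + (?D xs)\<^sup>2)"
      by (intro Bochner_Integration.integral_cong) (auto simp: power2_eq_square algebra_simps)
    also have "\<dots> = (f x - \<mu>)\<^sup>2 + 2 * (f x - \<mu>) * ?E ?D + ?E (\<lambda>xs. (?D xs)\<^sup>2)"
      by simp
    \<comment> \<open>The cross term is a constant times the mean of the centred sum, which
      vanishes.\<close>
    also have "?E ?D = 0"
      by (simp add: expectation_sum_replicate_pmf)
    finally show ?thesis using Suc by simp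
  qed
  then show ?case
    by (simp add: expectation_replicate_pmf_Suc[OF fin] del: replicate_pmf.simps sum_list.Cons list.map)
       (simp add: \<mu>_def algebra_simps)
qed simp

lemma Chebyshev_replicate_pmf:
  assumes "a > 0"
  shows "measure_pmf.prob (replicate_pmf n p) {xs. a \<le> \<bar>(\<Sum>x\<leftarrow>xs. f x) - real n * \<mu>\<bar>} \<le>
    real n * measure_pmf.variance p f / a\<^sup>2"
proof -
  note int = integrable_measure_pmf_finite[OF finite_set_replicate_pmf[OF fin]]
  have "measure_pmf.prob (replicate_pmf n p)
      {xs \<in> space (measure_pmf (replicate_pmf n p)). a \<le> \<bar>(\<Sum>x\<leftarrow>xs. f x) -
        measure_pmf.expectation (replicate_pmf n p) (\<lambda>xs. \<Sum>x\<leftarrow>xs. f x)\<bar>} \<le>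
      measure_pmf.variance (replicate_pmf n p) (\<lambda>xs. \<Sum>x\<leftarrow>xs. f x) / a\<^sup>2"
    by (rule measure_pmf.Chebyshev_inequality) (simp_all add: int assms)
  then show ?thesis
    unfolding expectation_sum_replicate_pmf variance_sum_replicate_pmf by simp
qed

text \<open>For values in [0, 1] the square is at most the value itself. Chebyshev's inequality then
  controls the error relative to the mean with order 1 / \<open>\<mu>\<close> samples.\<close>

lemma variance_le_expectation:
  assumes "\<And>x. x \<in> set_pmf p \<Longrightarrow> f x \<in> {0..1}"
  shows "measure_pmf.variance p f \<le> \<mu>"
proof -
  note [simp] = integrable_measure_pmf_finite[OF fin]
  have "measure_pmf.variance p f = measure_pmf.expectation p (\<lambda>x. (f x)\<^sup>2) - \<mu>\<^sup>2"
    unfolding \<mu>_def by (rule measure_pmf.variance_eq) auto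
  also have "\<dots> \<le> measure_pmf.expectation p (\<lambda>x. (f x)\<^sup>2)"
    by simp
  also have "\<dots> \<le> \<mu>"
    unfolding \<mu>_def using assms
    by (intro integral_mono_AE) (auto simp: AE_measure_pmf_iff power2_eq_square mult_left_le)
  finally show ?thesis .
qed

end

text \<open>A prefix of an independent sample is an independent sample. Events at an earlier fixed
  time can thus be evaluated inside a longer sample.\<close>

lemma prob_take_replicate_pmf:
  assumes "k \<le> n"
  shows "measure_pmf.prob (replicate_pmf n p) {xs. take k xs \<in> X} =
    measure_pmf.prob (replicate_pmf k p) X"
proof -
  have "map_pmf (take k) (replicate_pmf n p) = replicate_pmf k p" (is "?L = _")
  proof -
    have "?L = map_pmf (take k) (replicate_pmf (k + (n - k)) p)"
      using assms by simp
    also have "\<dots> = bind_pmf (replicate_pmf k p)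
        (\<lambda>xs. bind_pmf (replicate_pmf (n - k) p) (\<lambda>ys. return_pmf (take k (xs @ ys))))"
      unfolding replicate_pmf_distrib by (simp add: map_bind_pmf)
    also have "\<dots> = bind_pmf (replicate_pmf k p) (\<lambda>xs. return_pmf xs)"
      by (intro bind_pmf_cong refl) (auto simp: set_replicate_pmf)
    finally show ?thesis by (simp add: bind_return_pmf')
  qed
  then show ?thesis
    by (metis measure_map_pmf vimage_def)
qed

lemma prob_exists_replicate_pmf_le:
  "measure_pmf.prob (replicate_pmf n p) {xs. \<exists>x\<in>set xs. P x} \<le> real n * measure_pmf.prob p {x. P x}"
proof (induction n)
  case (Suc n)
  have "measure_pmf.prob (replicate_pmf (Suc n) p) {xs. \<exists>x\<in>set xs. P x} =
      measure_pmf.expectation p (\<lambda>x. measure_pmf.prob (map_pmf ((#) x) (replicate_pmf n p)) {xs. \<exists>x\<in>set xs. P x})"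
    by (simp add: measure_bind_pmf map_pmf_def)
  also have "\<dots> \<le> measure_pmf.expectation p (\<lambda>x. indicator {x. P x} x + real n * measure_pmf.prob p {x. P x})"
  proof (intro integral_mono integrable_prob)
    fix x
    show "measure_pmf.prob (map_pmf ((#) x) (replicate_pmf n p)) {xs. \<exists>x\<in>set xs. P x} \<le>
      indicator {x. P x} x + real n * measure_pmf.prob p {x. P x}"
    proof (cases "P x")
      case True
      then show ?thesis by (simp add: add_increasing2)
    next
      case False
      then have "(#) x -` {xs. \<exists>x\<in>set xs. P x} = {xs. \<exists>x\<in>set xs. P x}" by auto
      then show ?thesis using Suc False by simp
    qed
  qed (auto intro!: Bochner_Integration.integrable_add simp: integrable_real_indicator less_top[symmetric])
  also have "\<dots> = real (Suc n) * measure_pmf.prob p {x. P x}"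
    by (subst Bochner_Integration.integral_add)
       (auto simp: integrable_real_indicator less_top[symmetric] algebra_simps)
  finally show ?case .
qed simp

lemma prob_all_replicate_pmf:
  "measure_pmf.prob (replicate_pmf n p) {xs. \<forall>x\<in>set xs. P x} = measure_pmf.prob p {x. P x} ^ n"
proof (induction n)
  case (Suc n)
  have "measure_pmf.prob (map_pmf ((#) x) (replicate_pmf n p)) {xs. \<forall>x\<in>set xs. P x} =
      indicator {x. P x} x * measure_pmf.prob p {x. P x} ^ n" for x
  proof (cases "P x")
    case True
    then have "(#) x -` {xs. \<forall>x\<in>set xs. P x} = {xs. \<forall>x\<in>set xs. P x}" by auto
    then show ?thesis using Suc True by simp
  next
    case False
    then have "(#) x -` {xs. \<forall>x\<in>set xs. P x} = {}" by auto
    then show ?thesis using Suc False by simp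
  qed
  then show ?case
    by (simp add: measure_bind_pmf map_pmf_def)
qed simp

section \<open>A stopping rule\<close>

text \<open>The premise of the first implication singles out \<open>t\<close> as the first passage
  time of the level \<Upsilon>, so that \<Upsilon> / \<open>t\<close> estimates
  \<open>\<mu>\<close>; the second conjunct bounds this time. Since both concern a fixed list, the
  random stopping time can be analysed on samples drawn in advance.\<close>

definition accurate_stop :: "('a \<Rightarrow> real) \<Rightarrow> real \<Rightarrow> real \<Rightarrow> real \<Rightarrow> 'a list \<Rightarrow> bool" where
  "accurate_stop f \<mu> \<Upsilon> \<eta> xs \<longleftrightarrow>
    (\<forall>t\<le>length xs. \<Upsilon> \<le> (\<Sum>x\<leftarrow>take t xs. f x) \<and> (\<forall>s<t. (\<Sum>x\<leftarrow>take s xs. f x) < \<Upsilon>) \<longrightarrow>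
      (1 - \<eta>) * \<Upsilon> < real t * \<mu> \<and> real t * \<mu> \<le> (1 + 2 * \<eta>) * \<Upsilon>) \<and>
    ((1 + 2 * \<eta>) * \<Upsilon> \<le> real (length xs) * \<mu> \<longrightarrow> \<Upsilon> \<le> (\<Sum>x\<leftarrow>xs. f x))"

lemma sum_list_take_mono:
  fixes f :: "'a \<Rightarrow> real"
  assumes "\<And>x. 0 \<le> f x" "s \<le> t"
  shows "(\<Sum>x\<leftarrow>take s xs. f x) \<le> (\<Sum>x\<leftarrow>take t xs. f x)"
proof -
  have "take t xs = take s xs @ take (t - s) (drop s xs)"
    using assms(2) by (metis le_add_diff_inverse take_add)
  then show ?thesis
    using assms(1) by (auto intro!: sum_list_nonneg)
qed

text \<open>As \<open>f\<close> is nonnegative, the partial sums increase. First passage is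
  therefore confined by the values of the sum at two fixed times, which replaces a union over all
  times.\<close>

lemma accurate_stopI:
  fixes T :: nat
  assumes f: "\<And>x. 0 \<le> f x" and \<mu>: "0 < \<mu>" "\<mu> \<le> \<eta> * \<Upsilon>" and \<Upsilon>: "0 < \<Upsilon>" and \<eta>: "0 < \<eta>" "\<eta> \<le> 1 / 2"
    and len: "length xs = T"
    and s1: "s1 = min T (nat \<lfloor>(1 - \<eta>) * \<Upsilon> / \<mu>\<rfloor>)" and s2: "s2 = nat \<lceil>(1 + \<eta>) * \<Upsilon> / \<mu>\<rceil>"
    and lower: "(\<Sum>x\<leftarrow>take s1 xs. f x) < \<Upsilon>"
    and upper: "s2 \<le> T \<Longrightarrow> \<Upsilon> \<le> (\<Sum>x\<leftarrow>take s2 xs. f x)"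
  shows "accurate_stop f \<mu> \<Upsilon> \<eta> xs"
proof -
  have "real s2 < (1 + \<eta>) * \<Upsilon> / \<mu> + 1"
  proof -
    have "0 < (1 + \<eta>) * \<Upsilon> / \<mu>"
      using \<mu> \<Upsilon> \<eta> by simp
    then show ?thesis unfolding s2 by linarith
  qed
  \<comment> \<open>Rounding up costs at most one more sample, i.e. \<open>\<mu>\<close>, which is
    at most \<eta> * \<Upsilon>; hence the factor 1 + 2 * \<eta>.\<close>
  then have s2_le: "real s2 * \<mu> \<le> (1 + 2 * \<eta>) * \<Upsilon>"
    using \<mu> by (simp add: field_simps)
  have "(1 - \<eta>) * \<Upsilon> < real t * \<mu> \<and> real t * \<mu> \<le> (1 + 2 * \<eta>) * \<Upsilon>"
    if t: "t \<le> T" "\<Upsilon> \<le> (\<Sum>x\<leftarrow>take t xs. f x)" "\<And>s. s < t \<Longrightarrow> (\<Sum>x\<leftarrow>take s xs. f x) < \<Upsilon>" for t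
  proof
    have "\<not> t \<le> s1"
      using sum_list_take_mono[of f t s1 xs, OF f] t(2) lower by linarith
    then have "nat \<lfloor>(1 - \<eta>) * \<Upsilon> / \<mu>\<rfloor> < t"
      using t(1) s1 by auto
    then have "(1 - \<eta>) * \<Upsilon> / \<mu> < real t"
      by linarith
    then show "(1 - \<eta>) * \<Upsilon> < real t * \<mu>"
      using \<mu> by (simp add: field_simps)
    \<comment> \<open>This is immediate if \<open>s2\<close> exceeds the sample length; otherwise a
      first passage after \<open>s2\<close> contradicts \<open>upper\<close>.\<close>
    have "t \<le> s2"
      using t upper by (cases "s2 \<le> T") (auto simp: not_less[symmetric])
    then have "real t * \<mu> \<le> real s2 * \<mu>"
      using \<mu> by simp
    then show "real t * \<mu> \<le> (1 + 2 * \<eta>) * \<Upsilon>"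
      using s2_le by linarith
  qed
  moreover have "\<Upsilon> \<le> (\<Sum>x\<leftarrow>xs. f x)" if "(1 + 2 * \<eta>) * \<Upsilon> \<le> real T * \<mu>"
  proof -
    have "real s2 \<le> real T"
      using that s2_le \<mu> by (meson mult_le_cancel_right_pos order.trans)
    then show ?thesis
      using upper sum_list_take_mono[of f s2 T xs, OF f] len by simp
  qed
  ultimately show ?thesis
    unfolding accurate_stop_def len by blast
qed

text \<open>Chebyshev's inequality at the two times of \<open>accurate_stopI\<close>, with deviation
  \<eta> * \<Upsilon> and variance at most the mean. The mean is at most \<Upsilon> at
  \<open>s1\<close> and 2 * \<Upsilon> at \<open>s2\<close>, which gives 1 + 2 = 3.\<close>

lemma prob_accurate_stop:
  fixes p :: "'a pmf"
  assumes fin: "finite (set_pmf p)" and f: "\<And>x. f x \<in> {0..1}"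
    and \<mu>_def: "\<mu> = measure_pmf.expectation p f" and "0 < \<mu>"
    and \<eta>: "0 < \<eta>" "\<eta> \<le> 1 / 2" and \<Upsilon>: "1 \<le> \<eta> * \<Upsilon>"
  shows "measure_pmf.prob (replicate_pmf T p) {xs. \<not> accurate_stop f \<mu> \<Upsilon> \<eta> xs} \<le> 3 / (\<eta>\<^sup>2 * \<Upsilon>)"
proof -
  define s1 where "s1 = min T (nat \<lfloor>(1 - \<eta>) * \<Upsilon> / \<mu>\<rfloor>)"
  define s2 where "s2 = nat \<lceil>(1 + \<eta>) * \<Upsilon> / \<mu>\<rceil>"
  define P where "P s X = measure_pmf.prob (replicate_pmf s p) X" for s X
  have "0 < \<Upsilon>"
    using zero_less_mult_pos[of \<eta> \<Upsilon>] \<Upsilon> \<eta> by simp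
  have "\<mu> \<le> measure_pmf.expectation p (\<lambda>_. 1)"
    unfolding \<mu>_def using f by (intro integral_mono integrable_measure_pmf_finite[OF fin]) auto
  then have "\<mu> \<le> \<eta> * \<Upsilon>" using \<Upsilon> by simp
  have dev: "P s {xs. \<eta> * \<Upsilon> \<le> \<bar>(\<Sum>x\<leftarrow>xs. f x) - real s * \<mu>\<bar>} \<le> a / (\<eta>\<^sup>2 * \<Upsilon>)"
    if "real s * \<mu> \<le> a * \<Upsilon>" for s a
  proof -
    have "P s {xs. \<eta> * \<Upsilon> \<le> \<bar>(\<Sum>x\<leftarrow>xs. f x) - real s * \<mu>\<bar>} \<le> real s * measure_pmf.variance p f / (\<eta> * \<Upsilon>)\<^sup>2"
      unfolding P_def \<mu>_def using \<eta> \<open>0 < \<Upsilon>\<close> by (intro Chebyshev_replicate_pmf[OF fin]) simp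
    also have "\<dots> \<le> real s * \<mu> / (\<eta> * \<Upsilon>)\<^sup>2"
      unfolding \<mu>_def using variance_le_expectation[OF fin f]
      by (intro divide_right_mono mult_left_mono) auto
    also have "\<dots> \<le> a * \<Upsilon> / (\<eta> * \<Upsilon>)\<^sup>2"
      using that by (intro divide_right_mono) auto
    also have "\<dots> = a / (\<eta>\<^sup>2 * \<Upsilon>)"
      using \<open>0 < \<Upsilon>\<close> by (simp add: power2_eq_square)
    finally show ?thesis .
  qed
  have "real s1 \<le> (1 - \<eta>) * \<Upsilon> / \<mu>"
  proof -
    have "real s1 \<le> real (nat \<lfloor>(1 - \<eta>) * \<Upsilon> / \<mu>\<rfloor>)" unfolding s1_def by simp
    also have "\<dots> \<le> (1 - \<eta>) * \<Upsilon> / \<mu>"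
      using \<eta> \<open>0 < \<Upsilon>\<close> \<open>0 < \<mu>\<close> by (subst of_nat_nat) auto
    finally show ?thesis .
  qed
  then have s1: "real s1 * \<mu> \<le> (1 - \<eta>) * \<Upsilon>"
    using \<open>0 < \<mu>\<close> by (simp add: field_simps)
  have s2: "(1 + \<eta>) * \<Upsilon> \<le> real s2 * \<mu>" "real s2 * \<mu> \<le> 2 * \<Upsilon>"
  proof -
    have pos: "0 < (1 + \<eta>) * \<Upsilon> / \<mu>"
      using \<eta> \<open>0 < \<Upsilon>\<close> \<open>0 < \<mu>\<close> by simp
    have "(1 + \<eta>) * \<Upsilon> / \<mu> \<le> real s2"
      unfolding s2_def by linarith
    then show "(1 + \<eta>) * \<Upsilon> \<le> real s2 * \<mu>"
      using \<open>0 < \<mu>\<close> by (simp add: field_simps)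
    have "real s2 < (1 + \<eta>) * \<Upsilon> / \<mu> + 1"
      unfolding s2_def using pos by linarith
    then have "real s2 * \<mu> \<le> (1 + 2 * \<eta>) * \<Upsilon>"
      using \<open>0 < \<mu>\<close> \<open>\<mu> \<le> \<eta> * \<Upsilon>\<close> by (simp add: field_simps)
    also have "\<dots> \<le> 2 * \<Upsilon>"
      using \<eta> \<open>0 < \<Upsilon>\<close> by simp
    finally show "real s2 * \<mu> \<le> 2 * \<Upsilon>" .
  qed
  define B1 where "B1 = {xs. take s1 xs \<in> {xs. \<Upsilon> \<le> (\<Sum>x\<leftarrow>xs. f x)}}"
  define B2 where "B2 = {xs. s2 \<le> T \<and> take s2 xs \<in> {xs. (\<Sum>x\<leftarrow>xs. f x) < \<Upsilon>}}"
  have "P T B1 = P s1 {xs. \<Upsilon> \<le> (\<Sum>x\<leftarrow>xs. f x)}"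
    unfolding B1_def P_def by (intro prob_take_replicate_pmf) (simp add: s1_def)
  also have "\<dots> \<le> P s1 {xs. \<eta> * \<Upsilon> \<le> \<bar>(\<Sum>x\<leftarrow>xs. f x) - real s1 * \<mu>\<bar>}"
    unfolding P_def using s1 by (intro measure_pmf.finite_measure_mono) (auto simp: algebra_simps)
  also have "\<dots> \<le> 1 / (\<eta>\<^sup>2 * \<Upsilon>)"
    by (rule dev[OF order.trans[OF s1]]) (use \<eta> \<open>0 < \<Upsilon>\<close> in simp)
  finally have B1: "P T B1 \<le> 1 / (\<eta>\<^sup>2 * \<Upsilon>)" .
  have B2: "P T B2 \<le> 2 / (\<eta>\<^sup>2 * \<Upsilon>)"
  proof (cases "s2 \<le> T")
    case True
    then have "P T B2 = P s2 {xs. (\<Sum>x\<leftarrow>xs. f x) < \<Upsilon>}"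
      unfolding B2_def P_def using prob_take_replicate_pmf[of s2 T p "{xs. (\<Sum>x\<leftarrow>xs. f x) < \<Upsilon>}"] by simp
    also have "\<dots> \<le> P s2 {xs. \<eta> * \<Upsilon> \<le> \<bar>(\<Sum>x\<leftarrow>xs. f x) - real s2 * \<mu>\<bar>}"
      unfolding P_def using s2 by (intro measure_pmf.finite_measure_mono) (auto simp: algebra_simps)
    also have "\<dots> \<le> 2 / (\<eta>\<^sup>2 * \<Upsilon>)"
      using s2 by (intro dev)
    finally show ?thesis .
  next
    case False
    then show ?thesis
      using \<open>0 < \<Upsilon>\<close> by (simp add: B2_def P_def)
  qed
  have "P T {xs. \<not> accurate_stop f \<mu> \<Upsilon> \<eta> xs} \<le> P T (B1 \<union> B2)"
    unfolding P_def
  proof (intro measure_pmf.finite_measure_mono_AE)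
    show "AE xs in replicate_pmf T p. xs \<in> {xs. \<not> accurate_stop f \<mu> \<Upsilon> \<eta> xs} \<longrightarrow> xs \<in> B1 \<union> B2"
    proof (rule AE_pmfI, intro impI)
      fix xs assume xs: "xs \<in> set_pmf (replicate_pmf T p)" "xs \<in> {xs. \<not> accurate_stop f \<mu> \<Upsilon> \<eta> xs}"
      show "xs \<in> B1 \<union> B2"
      proof (rule ccontr)
        assume "xs \<notin> B1 \<union> B2"
        then have "accurate_stop f \<mu> \<Upsilon> \<eta> xs"
          using xs f
          by (intro accurate_stopI[OF _ \<open>0 < \<mu>\<close> \<open>\<mu> \<le> \<eta> * \<Upsilon>\<close> \<open>0 < \<Upsilon>\<close> \<eta> _ s1_def s2_def])
             (simp_all add: B1_def B2_def set_replicate_pmf not_le not_less)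
        then show False using xs by simp
      qed
    qed
  qed simp
  also have "\<dots> \<le> P T B1 + P T B2"
    unfolding P_def by (intro measure_Un_le) auto
  also have "\<dots> \<le> 3 / (\<eta>\<^sup>2 * \<Upsilon>)"
    using add_mono[OF B1 B2] unfolding add_divide_distrib[symmetric] by simp
  finally show ?thesis unfolding P_def .
qed

section \<open>Sampling algorithms\<close>

lemma simple_graph_edgeE:
  assumes "simple_graph G" "e \<in> edges G"
  obtains u v where "u \<in> verts G" "v \<in> verts G" "u < v" "e = {u, v}"
proof -
  obtain u v where uv: "u \<in> verts G" "v \<in> verts G" "u \<noteq> v" "e = {u, v}"
    using assms unfolding simple_graph_def by blast
  then show ?thesis
    using that[of u v] that[of v u] by (metis insert_commute linorder_neqE_nat)
qed

lemma finite_edges: "simple_graph G \<Longrightarrow> finite (edges G)"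
  by (rule finite_subset[of _ "Pow (verts G)"]) (auto simp: simple_graph_def)

lemma nbrs_subset: "simple_graph G \<Longrightarrow> nbrs G x \<subseteq> verts G"
  by (auto simp: nbrs_def simple_graph_def doubleton_eq_iff)

lemma finite_nbrs: "simple_graph G \<Longrightarrow> finite (nbrs G x)"
  using nbrs_subset finite_subset simple_graph_def by metis

lemma edges_nonempty: "input_graph G \<Longrightarrow> edges G \<noteq> {}"
  unfolding input_graph_def simple_graph_def no_isolated_def deg_def nbrs_def by force

lemma card_incident_edges:
  assumes "simple_graph G"
  shows "card {e \<in> edges G. x \<in> e} = deg G x"
proof -
  have "{e \<in> edges G. x \<in> e} = (\<lambda>y. {x, y}) ` nbrs G x"
  proof (intro equalityI subsetI)
    fix e assume "e \<in> {e \<in> edges G. x \<in> e}"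
    moreover from this obtain u v where "e = {u, v}"
      using assms by (auto elim: simple_graph_edgeE)
    ultimately show "e \<in> (\<lambda>y. {x, y}) ` nbrs G x"
      by (auto simp: nbrs_def insert_commute)
  qed (auto simp: nbrs_def)
  moreover have "inj_on (\<lambda>y. {x, y}) (nbrs G x)"
    by (auto simp: inj_on_def doubleton_eq_iff)
  ultimately show ?thesis
    by (simp add: deg_def card_image)
qed

text \<open>Double counting of incident pairs of a vertex and an edge. \<open>Min\<close> and
  \<open>Max\<close> name the two ends of an edge, which is an unordered set.\<close>

lemma sum_over_edge_ends:
  fixes g :: "nat \<Rightarrow> real"
  assumes G: "simple_graph G"
  shows "(\<Sum>e\<in>edges G. g (Min e) + g (Max e)) = (\<Sum>x\<in>verts G. real (deg G x) * g x)"
proof -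
  have fin: "finite (verts G)" "finite (edges G)"
    using G finite_edges by (auto simp: simple_graph_def)
  have "(\<Sum>e\<in>edges G. g (Min e) + g (Max e)) = (\<Sum>e\<in>edges G. \<Sum>x | x \<in> verts G \<and> x \<in> e. g x)"
  proof (rule sum.cong[OF refl])
    fix e assume "e \<in> edges G"
    then obtain u v where "u \<in> verts G" "v \<in> verts G" "u < v" "e = {u, v}"
      using G by (elim simple_graph_edgeE)
    moreover from this have "{x. x \<in> verts G \<and> x \<in> e} = {u, v}" by auto
    ultimately show "g (Min e) + g (Max e) = (\<Sum>x | x \<in> verts G \<and> x \<in> e. g x)" by simp
  qed
  also have "\<dots> = (\<Sum>x\<in>verts G. \<Sum>e | e \<in> edges G \<and> x \<in> e. g x)"
    by (rule sum.swap_restrict[OF fin(2,1)])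
  also have "\<dots> = (\<Sum>x\<in>verts G. real (deg G x) * g x)"
    by (simp add: card_incident_edges[OF G])
  finally show ?thesis .
qed

lemma sum_deg: "simple_graph G \<Longrightarrow> (\<Sum>x\<in>verts G. real (deg G x)) = 2 * real (num_edges G)"
  using sum_over_edge_ends[of G "\<lambda>_. 1"] by (simp add: num_edges_def)

section \<open>Block-wise sampling and its reduction to independent samples\<close>

definition sample_pmf :: "graph \<Rightarrow> (nat \<times> nat \<times> nat) pmf" where
  "sample_pmf G = bind_pmf (pmf_of_set (verts G)) (\<lambda>w. bind_pmf (pmf_of_set (edges G))
    (\<lambda>e. return_pmf (deg G w, deg G (Min e), deg G (Max e))))"

text \<open>
  The history consists of blocks of five queries: a random vertex and its degree, a random edge and the
  degrees of its two ends.  The position inside the block is read off the length of the history.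
\<close>

primrec answer_number :: "answer \<Rightarrow> nat" where
  "answer_number (Vertex x) = x"
| "answer_number (Number k) = k"
| "answer_number (Edge e) = 0"
| "answer_number (Nbrs X) = 0"
| "answer_number Invalid = 0"

primrec answer_edge :: "answer \<Rightarrow> nat set" where
  "answer_edge (Vertex x) = {}"
| "answer_edge (Number k) = {}"
| "answer_edge (Edge e) = e"
| "answer_edge (Nbrs X) = {}"
| "answer_edge Invalid = {}"

fun samples :: "history \<Rightarrow> (nat \<times> nat \<times> nat) list" where
  "samples (x1 # x2 # x3 # x4 # x5 # h) =
    (answer_number (snd x2), answer_number (snd x4), answer_number (snd x5)) # samples h"
| "samples _ = []"

text \<open>The first history is the complete one, on which \<open>dec\<close> decides; the second
  is its unfinished block, whose length selects the query.\<close>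

fun next_action :: "((nat \<times> nat \<times> nat) list \<Rightarrow> real option) \<Rightarrow> history \<Rightarrow> history \<Rightarrow> action" where
  "next_action dec h [] = (case dec (samples h) of Some r \<Rightarrow> Return r | None \<Rightarrow> Ask RandVert)"
| "next_action dec h [x1] = Ask (Degree (answer_number (snd x1)))"
| "next_action dec h [x1, x2] = Ask RandEdge"
| "next_action dec h [x1, x2, x3] = Ask (Degree (Min (answer_edge (snd x3))))"
| "next_action dec h (x1 # x2 # x3 # x4 # _) = Ask (Degree (Max (answer_edge (snd x3))))"

definition sampling_algorithm :: "((nat \<times> nat \<times> nat) list \<Rightarrow> real option) \<Rightarrow> algorithm" where
  "sampling_algorithm dec h = return_pmf (next_action dec h (drop (5 * (length h div 5)) h))"

text \<open>A stopping rule applied to a list drawn in advance: \<omega> is the prefix already seen,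
  and entries after the decision are ignored.\<close>

primrec first_decision :: "('a list \<Rightarrow> real option) \<Rightarrow> 'a list \<Rightarrow> 'a list \<Rightarrow> real option" where
  "first_decision dec \<omega> [] = dec \<omega>"
| "first_decision dec \<omega> (z # zs) =
    (case dec \<omega> of Some r \<Rightarrow> Some r | None \<Rightarrow> first_decision dec (\<omega> @ [z]) zs)"

lemma uses_only_sampling_algorithm: "uses_only (base_model \<union> {RandEdge}) (sampling_algorithm dec)"
proof -
  have "Ask q = next_action dec h xs \<Longrightarrow> q \<in> base_model \<union> {RandEdge}" for q h xs
    by (induction dec h xs rule: next_action.induct) (auto simp: base_model_def split: option.splits)
  then show ?thesis
    by (auto simp: uses_only_def sampling_algorithm_def)
qed

lemma samples_append: "length h mod 5 = 0 \<Longrightarrow> samples (h @ h') = samples h @ samples h'"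
  by (induction h rule: samples.induct) auto

lemma sampling_algorithm_append:
  assumes "length h mod 5 = 0" "length xs < 5"
  shows "sampling_algorithm dec (h @ xs) = return_pmf (next_action dec (h @ xs) xs)"
proof -
  have "5 * ((length h + length xs) div 5) = length h"
    using assms by presburger
  then show ?thesis
    by (simp add: sampling_algorithm_def)
qed

lemma sampling_algorithm_Nil:
  assumes "length h mod 5 = 0"
  shows "sampling_algorithm dec h =
    return_pmf (case dec (samples h) of Some r \<Rightarrow> Return r | None \<Rightarrow> Ask RandVert)"
  using sampling_algorithm_append[OF assms, of "[]"] by simp

text \<open>Each sample costs five queries. Drawing all samples in advance changes nothing, because
  those after the decision are not looked at; the adaptive run becomes a function of an independent
  sample.\<close>

lemma run_sampling_algorithm:
  assumes G: "input_graph G" and "length h mod 5 = 0"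
  shows "run (sampling_algorithm dec) G (5 * s) h =
    map_pmf (first_decision dec (samples h)) (replicate_pmf s (sample_pmf G))"
  using assms(2)
proof (induction s arbitrary: h)
  case 0
  then show ?case
    by (simp add: sampling_algorithm_Nil bind_return_pmf split: option.splits)
next
  case (Suc s)
  note [simp] = bind_return_pmf
  have fin: "finite (verts G)" "verts G \<noteq> {}" "finite (edges G)" "edges G \<noteq> {}"
    using G finite_edges edges_nonempty by (auto simp: input_graph_def simple_graph_def)
  have eq: "5 * Suc s = Suc (Suc (Suc (Suc (Suc (5 * s)))))" by simp
  show ?case
  proof (cases "dec (samples h)")
    case (Some r)
    \<comment> \<open>After a decision the remaining samples are integrated out.\<close>
    have "first_decision dec (samples h) \<circ> (#) x = (\<lambda>_. Some r)" for x
      using Some by auto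
    then show ?thesis
      using Suc.prems Some
      by (simp add: eq sampling_algorithm_Nil map_bind_pmf bind_pmf_const del: mult_Suc_right)
  next
    case None
    have step: "sampling_algorithm dec (h @ xs) = return_pmf (next_action dec (h @ xs) xs)" if "length xs < 5" for xs
      using Suc.prems that by (rule sampling_algorithm_append)
    let ?run = "run (sampling_algorithm dec) G"
    have "?run (5 * Suc s) h = bind_pmf (pmf_of_set (verts G)) (\<lambda>w. bind_pmf (pmf_of_set (edges G)) (\<lambda>e.
        ?run (5 * s) (h @ [(RandVert, Vertex w), (Degree w, Number (deg G w)), (RandEdge, Edge e),
          (Degree (Min e), Number (deg G (Min e))), (Degree (Max e), Number (deg G (Max e)))])))"
      unfolding eq using Suc.prems None
    proof (simp add: sampling_algorithm_Nil map_pmf_def bind_assoc_pmf step, intro bind_pmf_cong refl, goal_cases)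
      case (1 w e)
      \<comment> \<open>Both ends of a sampled edge are vertices, so the two degree queries are
        answered by numbers and not by \<open>Invalid\<close>.\<close>
      then have "e \<in> edges G"
        using fin by simp
      then obtain u v where "u \<in> verts G" "v \<in> verts G" "u < v" "e = {u, v}"
        using G unfolding input_graph_def by (metis simple_graph_edgeE)
      then show ?case
        using 1 fin by (simp add: step)
    qed
    also have "\<dots> = bind_pmf (pmf_of_set (verts G)) (\<lambda>w. bind_pmf (pmf_of_set (edges G)) (\<lambda>e.
        map_pmf (first_decision dec (samples h @ [(deg G w, deg G (Min e), deg G (Max e))]))
          (replicate_pmf s (sample_pmf G))))"
      using Suc.prems by (simp add: Suc.IH samples_append)
    also have "\<dots> = map_pmf (first_decision dec (samples h)) (replicate_pmf (Suc s) (sample_pmf G))"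
      using None by (simp add: sample_pmf_def map_bind_pmf bind_assoc_pmf map_pmf_def)
    finally show ?thesis .
  qed
qed

section \<open>Statistics of a sample\<close>

lemma finite_sample_pmf: "input_graph G \<Longrightarrow> finite (set_pmf (sample_pmf G))"
  using finite_edges edges_nonempty
  by (auto simp: sample_pmf_def input_graph_def simple_graph_def)

lemma expectation_sample_pmf_vertex:
  assumes "input_graph G"
  shows "measure_pmf.expectation (sample_pmf G) (\<lambda>(a, b, c). g a) =
    (\<Sum>x\<in>verts G. g (deg G x)) / real (num_verts G)"
proof -
  have fin: "finite (verts G)" "verts G \<noteq> {}" "finite (edges G)" "edges G \<noteq> {}"
    using assms finite_edges edges_nonempty by (auto simp: input_graph_def simple_graph_def)
  then show ?thesis
    by (simp add: sample_pmf_def expectation_bind_pmf_finite integral_pmf_of_set num_verts_def)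
qed

text \<open>A random end of a random edge is a given vertex with probability proportional to its
  degree.\<close>

lemma expectation_sample_pmf_edge:
  fixes g :: "nat \<Rightarrow> real"
  assumes "input_graph G"
  shows "measure_pmf.expectation (sample_pmf G) (\<lambda>(a, b, c). (g b + g c) / 2) =
    (\<Sum>x\<in>verts G. real (deg G x) * g (deg G x)) / (2 * real (num_edges G))"
proof -
  have fin: "finite (verts G)" "verts G \<noteq> {}" "finite (edges G)" "edges G \<noteq> {}"
    using assms finite_edges edges_nonempty by (auto simp: input_graph_def simple_graph_def)
  have "measure_pmf.expectation (sample_pmf G) (\<lambda>(a, b, c). (g b + g c) / 2) =
      (\<Sum>e\<in>edges G. (g (deg G (Min e)) + g (deg G (Max e)))) / 2 / real (num_edges G)"
    using fin by (simp add: sample_pmf_def expectation_bind_pmf_finite integral_pmf_of_set num_edges_def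
        sum_divide_distrib mult.commute)
  also have "(\<Sum>e\<in>edges G. (g (deg G (Min e)) + g (deg G (Max e)))) =
      (\<Sum>x\<in>verts G. real (deg G x) * g (deg G x))"
    using assms sum_over_edge_ends[of G "\<lambda>x. g (deg G x)"] by (simp add: input_graph_def)
  finally show ?thesis by simp
qed

text \<open>The probability that a random end of a random edge has degree at most \<theta>.\<close>

definition low_fraction :: "graph \<Rightarrow> nat \<Rightarrow> real" where
  "low_fraction G \<theta> = (\<Sum>x\<in>verts G. real (deg G x) * of_bool (deg G x \<le> \<theta>)) / (2 * real (num_edges G))"

text \<open>The first condition lets the fraction be estimated from few edges; together with the
  second it keeps the mean of \<open>vertex_value\<close> large enough for an early stop.\<close>

definition good_threshold :: "graph \<Rightarrow> nat \<Rightarrow> bool" where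
  "good_threshold G \<theta> \<longleftrightarrow>
    1 / 10000 \<le> low_fraction G \<theta> \<and> real \<theta> \<le> 4 * sqrt (real (num_edges G))"

definition threshold :: "(nat \<times> nat \<times> nat) list \<Rightarrow> nat" where
  "threshold xs = Min ((\<lambda>(a, b, c). min b c) ` set xs)"

lemma good_threshold_pos:
  assumes "good_threshold G \<theta>"
  shows "0 < \<theta>"
proof (rule ccontr)
  assume "\<not> 0 < \<theta>"
  then have "(\<Sum>x\<in>verts G. real (deg G x) * of_bool (deg G x \<le> \<theta>)) = 0"
    by (intro sum.neutral) auto
  then show False
    using assms by (simp add: good_threshold_def low_fraction_def)
qed

definition edge_value :: "nat \<times> nat \<times> nat \<Rightarrow> real" where
  "edge_value = (\<lambda>(a, b, c). (1 / real b + 1 / real c) / 2)"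

text \<open>Division by \<theta> brings the truncated degree into [0, 1], where the variance is at
  most the mean.\<close>

definition vertex_value :: "nat \<Rightarrow> nat \<times> nat \<times> nat \<Rightarrow> real" where
  "vertex_value \<theta> = (\<lambda>(a, b, c). if a \<le> \<theta> then real a / real \<theta> else 0)"

definition low_value :: "nat \<Rightarrow> nat \<times> nat \<times> nat \<Rightarrow> real" where
  "low_value \<theta> = (\<lambda>(a, b, c). (of_bool (b \<le> \<theta>) + of_bool (c \<le> \<theta>)) / 2)"

lemma inverse_nat_le_1: "1 / real b \<le> 1"
  by (cases "b = 0") (auto simp: divide_simps)

lemma sample_values_range:
  "edge_value z \<in> {0..1}" "vertex_value \<theta> z \<in> {0..1}" "low_value \<theta> z \<in> {0..1}"
  using add_mono[OF inverse_nat_le_1 inverse_nat_le_1]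
  by (auto simp: edge_value_def vertex_value_def low_value_def divide_le_eq_1 split: prod.splits)

context
  fixes G :: graph and n m d :: real
  assumes G: "input_graph G"
  defines "n \<equiv> real (num_verts G)" and "m \<equiv> real (num_edges G)" and "d \<equiv> avg_deg G"
begin

lemma graph_facts: "finite (verts G)" "verts G \<noteq> {}" "finite (edges G)" "edges G \<noteq> {}" "simple_graph G"
  using G finite_edges edges_nonempty by (auto simp: input_graph_def simple_graph_def)

lemma n_m_pos: "1 \<le> n" "1 \<le> m"
  using graph_facts by (simp_all add: n_def m_def num_verts_def num_edges_def Suc_le_eq card_gt_0_iff)

lemma avg_deg_eq: "d = 2 * m / n"
  by (simp add: d_def n_def m_def avg_deg_def)

lemma avg_deg_bounds: "1 \<le> d" "d \<le> n"
proof -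
  have "n \<le> (\<Sum>x\<in>verts G. real (deg G x))"
    using sum_mono[of "verts G" "\<lambda>_. 1" "\<lambda>x. real (deg G x)"] G
    by (auto simp: n_def num_verts_def input_graph_def no_isolated_def Suc_le_eq)
  then show "1 \<le> d"
    using sum_deg[OF graph_facts(5)] n_m_pos by (simp add: avg_deg_eq m_def)
  have "(\<Sum>x\<in>verts G. real (deg G x)) \<le> (\<Sum>x\<in>verts G. n)"
    by (intro sum_mono) (simp add: n_def num_verts_def deg_def card_mono graph_facts nbrs_subset)
  also have "\<dots> = n * n"
    by (simp add: n_def num_verts_def)
  finally show "d \<le> n"
    using sum_deg[OF graph_facts(5)] n_m_pos by (simp add: avg_deg_eq m_def field_simps)
qed

text \<open>The degree bias of edge ends cancels the reciprocal degree, so each vertex contributes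
  exactly 1, none being isolated.\<close>

lemma expectation_edge_value: "measure_pmf.expectation (sample_pmf G) edge_value = 1 / d"
proof -
  have "(\<Sum>x\<in>verts G. real (deg G x) * (1 / real (deg G x))) = (\<Sum>x\<in>verts G. 1)"
    using G by (intro sum.cong) (auto simp: input_graph_def no_isolated_def)
  also have "\<dots> = n"
    by (simp add: n_def num_verts_def)
  finally have "(\<Sum>x\<in>verts G. real (deg G x) * (1 / real (deg G x))) = n" .
  then show ?thesis
    using expectation_sample_pmf_edge[OF G, of "\<lambda>b. 1 / real b"]
    by (simp add: edge_value_def avg_deg_eq m_def)
qed

lemma expectation_low_value: "measure_pmf.expectation (sample_pmf G) (low_value \<theta>) = low_fraction G \<theta>"
  using expectation_sample_pmf_edge[OF G, of "\<lambda>b. of_bool (b \<le> \<theta>)"]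
  by (simp add: low_value_def low_fraction_def)

text \<open>The low vertices carry the fraction \<open>low_fraction G \<theta>\<close> of the degree
  sum. Hence \<open>d\<close> can be recovered from this mean once the fraction has been estimated
  from edges.\<close>

lemma expectation_vertex_value:
  "measure_pmf.expectation (sample_pmf G) (vertex_value \<theta>) = low_fraction G \<theta> * d / real \<theta>"
proof -
  have "(\<Sum>x\<in>verts G. if deg G x \<le> \<theta> then real (deg G x) / real \<theta> else 0) =
      (\<Sum>x\<in>verts G. real (deg G x) * of_bool (deg G x \<le> \<theta>)) / real \<theta>"
    by (auto simp: sum_divide_distrib intro!: sum.cong)
  then show ?thesis
    using expectation_sample_pmf_vertex[OF G, of "\<lambda>a. if a \<le> \<theta> then real a / real \<theta> else 0"] n_m_pos
    by (simp add: vertex_value_def low_fraction_def avg_deg_eq n_def m_def field_simps)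
qed

lemma prob_low_le:
  "measure_pmf.prob (sample_pmf G) {(a, b, c). min b c \<le> \<theta>} \<le> 2 * low_fraction G \<theta>"
proof -
  have "measure_pmf.prob (sample_pmf G) {(a, b, c). min b c \<le> \<theta>} =
      measure_pmf.expectation (sample_pmf G) (indicator {(a, b, c). min b c \<le> \<theta>})"
    by simp
  also have "\<dots> \<le> measure_pmf.expectation (sample_pmf G) (\<lambda>z. 2 * low_value \<theta> z)"
    by (intro integral_mono integrable_measure_pmf_finite[OF finite_sample_pmf[OF G]])
       (auto simp: low_value_def indicator_def min_le_iff_disj)
  finally show ?thesis
    by (simp add: expectation_low_value)
qed

text \<open>The degree sum 2 * \<open>m\<close> leaves room for at most sqrt \<open>m\<close> / 2
  vertices of degree above 4 * sqrt \<open>m\<close>. An edge between two of them is determined by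
  the pair of its ends, so there are at most \<open>m\<close> / 4 such edges.\<close>

lemma prob_high_le:
  "measure_pmf.prob (sample_pmf G) {(a, b, c). 4 * sqrt m < real (min b c)} \<le> 1 / 4"
proof -
  define H where "H = {x \<in> verts G. 4 * sqrt m < real (deg G x)}"
  define EH where "EH = {e \<in> edges G. 4 * sqrt m < real (min (deg G (Min e)) (deg G (Max e)))}"
  have fin: "finite H" using graph_facts by (simp add: H_def)
  have "4 * sqrt m * real (card H) \<le> (\<Sum>x\<in>H. real (deg G x))"
    using sum_mono[of H "\<lambda>_. 4 * sqrt m" "\<lambda>x. real (deg G x)"] by (simp add: H_def mult.commute)
  also have "\<dots> \<le> (\<Sum>x\<in>verts G. real (deg G x))"
    using graph_facts by (intro sum_mono2) (auto simp: H_def)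
  also have "\<dots> = 2 * (sqrt m * sqrt m)"
    using n_m_pos by (simp add: sum_deg[OF graph_facts(5)] m_def)
  finally have "sqrt m * (2 * real (card H)) \<le> sqrt m * sqrt m"
    by linarith
  then have "2 * real (card H) \<le> sqrt m"
    by (rule mult_left_le_imp_le) (use n_m_pos in simp)
  then have "(2 * real (card H))\<^sup>2 \<le> (sqrt m)\<^sup>2"
    by (intro power_mono) auto
  then have H: "4 * (real (card H) * real (card H)) \<le> m"
    using n_m_pos by (simp add: power2_eq_square)
  have "inj_on (\<lambda>e. (Min e, Max e)) EH"
  proof (rule inj_onI)
    fix e e' assume e: "e \<in> EH" "e' \<in> EH" "(Min e, Max e) = (Min e', Max e')"
    then have "e \<in> edges G" "e' \<in> edges G"
      by (simp_all add: EH_def)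
    then obtain u v u' v' where "u < v" "e = {u, v}" "u' < v'" "e' = {u', v'}"
      using graph_facts(5) by (metis simple_graph_edgeE)
    then show "e = e'"
      using e(3) by simp
  qed
  moreover have "(Min e, Max e) \<in> H \<times> H" if "e \<in> EH" for e
  proof -
    have "e \<in> edges G"
      using that by (simp add: EH_def)
    then obtain u v where "u \<in> verts G" "v \<in> verts G" "u < v" "e = {u, v}"
      using graph_facts(5) by (metis simple_graph_edgeE)
    then show ?thesis
      using that by (simp add: EH_def H_def of_nat_min)
  qed
  then have "(\<lambda>e. (Min e, Max e)) ` EH \<subseteq> H \<times> H"
    by (rule image_subsetI)
  ultimately have "card EH \<le> card (H \<times> H)"
    using fin by (metis card_inj_on_le finite_cartesian_product)
  then have "real (card EH) \<le> real (card H) * real (card H)"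
    by (simp add: card_cartesian_product flip: of_nat_mult)
  then have EH: "real (card EH) \<le> m / 4"
    using H by linarith
  let ?X = "{(a, b, c). 4 * sqrt m < real (min b c)} :: (nat \<times> nat \<times> nat) set"
  \<comment> \<open>The event does not depend on the vertex degree, for which 0 stands as a
    placeholder.\<close>
  have "measure_pmf.prob (sample_pmf G) ?X =
      (\<Sum>e\<in>edges G. indicator ?X (0, deg G (Min e), deg G (Max e))) / m"
    using graph_facts
    by (simp add: sample_pmf_def measure_bind_pmf integral_pmf_of_set m_def num_edges_def indicator_def)
  also have "(\<Sum>e\<in>edges G. indicator ?X (0, deg G (Min e), deg G (Max e)) :: real) = (\<Sum>e\<in>EH. 1)"
    by (rule sum.mono_neutral_cong_right) (auto simp: graph_facts EH_def indicator_def)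
  also have "\<dots> = real (card EH)"
    by simp
  also have "real (card EH) / m \<le> 1 / 4"
    using EH n_m_pos by (simp add: field_simps)
  finally show ?thesis .
qed

lemma low_fraction_mono: "\<theta> \<le> \<theta>' \<Longrightarrow> low_fraction G \<theta> \<le> low_fraction G \<theta>'"
  unfolding low_fraction_def by (intro divide_right_mono sum_mono) auto

text \<open>The minimum is below \<open>\<theta>0\<close> only if one of five edges has such an end,
  with probability at most 5 * 2/10000. It exceeds 4 * sqrt \<open>m\<close> only if all five edges
  do, with probability at most 1/4^5 = 1/1024.\<close>

lemma prob_bad_threshold:
  "measure_pmf.prob (replicate_pmf 5 (sample_pmf G)) {xs. \<not> good_threshold G (threshold xs)} \<le> 2 / 1000"
proof -
  let ?p = "sample_pmf G"
  let ?P = "measure_pmf.prob (replicate_pmf 5 ?p)"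
  define \<theta>0 where "\<theta>0 = (LEAST \<theta>. 1 / 10000 \<le> low_fraction G \<theta>)"
  \<comment> \<open>At least three quarters of the edges have an end of degree at most 4 * sqrt
    \<open>m\<close>, so this threshold has low fraction at least 3/8.\<close>
  have "\<exists>\<theta>. 1 / 10000 \<le> low_fraction G \<theta>"
  proof
    have "1 - measure_pmf.prob ?p {(a, b, c). 4 * sqrt m < real (min b c)} =
        measure_pmf.prob ?p (UNIV - {(a, b, c). 4 * sqrt m < real (min b c)})"
      using measure_pmf.prob_compl[of "{(a, b, c). 4 * sqrt m < real (min b c)}" ?p] by simp
    also have "\<dots> \<le> measure_pmf.prob ?p {(a, b, c). min b c \<le> nat \<lfloor>4 * sqrt m\<rfloor>}"
      using n_m_pos by (intro measure_pmf.finite_measure_mono) (auto simp: le_nat_iff le_floor_iff)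
    also have "\<dots> \<le> 2 * low_fraction G (nat \<lfloor>4 * sqrt m\<rfloor>)"
      by (rule prob_low_le)
    finally show "1 / 10000 \<le> low_fraction G (nat \<lfloor>4 * sqrt m\<rfloor>)"
      using prob_high_le by simp
  qed
  then have \<theta>0: "1 / 10000 \<le> low_fraction G \<theta>0"
    unfolding \<theta>0_def by (rule LeastI_ex)
  have low: "measure_pmf.prob ?p {z. case z of (a, b, c) \<Rightarrow> min b c < \<theta>0} \<le> 2 / 10000"
  proof (cases \<theta>0)
    case (Suc \<theta>)
    then have "\<not> 1 / 10000 \<le> low_fraction G \<theta>"
      unfolding \<theta>0_def by (metis not_less_Least lessI)
    moreover have "measure_pmf.prob ?p {z. case z of (a, b, c) \<Rightarrow> min b c < \<theta>0} \<le> 2 * low_fraction G \<theta>"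
      using prob_low_le[of \<theta>] unfolding Suc less_Suc_eq_le .
    ultimately show ?thesis
      by linarith
  qed simp
  let ?B1 = "{xs. \<exists>z\<in>set xs. case z of (a, b, c) \<Rightarrow> min b c < \<theta>0}"
  let ?B2 = "{xs. \<forall>z\<in>set xs. case z of (a, b, c) \<Rightarrow> 4 * sqrt m < real (min b c)}"
  have "?P {xs. \<not> good_threshold G (threshold xs)} \<le> ?P (?B1 \<union> ?B2)"
  proof (intro measure_pmf.finite_measure_mono_AE AE_pmfI impI)
    fix xs assume xs: "xs \<in> set_pmf (replicate_pmf 5 ?p)" "xs \<in> {xs. \<not> good_threshold G (threshold xs)}"
    then have "set xs \<noteq> {}" by (auto simp: set_replicate_pmf simp del: replicate_pmf.simps)
    show "xs \<in> ?B1 \<union> ?B2"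
    proof (rule ccontr)
      assume *: "xs \<notin> ?B1 \<union> ?B2"
      have "threshold xs \<in> (\<lambda>(a, b, c). min b c) ` set xs"
        unfolding threshold_def using \<open>set xs \<noteq> {}\<close> by (intro Min_in) auto
      then obtain a b c where "(a, b, c) \<in> set xs" "threshold xs = min b c"
        by auto
      then have "\<theta>0 \<le> threshold xs"
        using * by (force simp: not_less)
      then have "1 / 10000 \<le> low_fraction G (threshold xs)"
        using \<theta>0 low_fraction_mono by (meson order.trans)
      moreover obtain a b c where "(a, b, c) \<in> set xs" "real (min b c) \<le> 4 * sqrt m"
        using * by (auto simp: not_less)
      moreover from this have "real (threshold xs) \<le> real (min b c)"
        unfolding threshold_def of_nat_le_iff
        by (intro Min_le) (auto intro!: image_eqI[of _ _ "(a, b, c)"])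
      ultimately have "good_threshold G (threshold xs)"
        unfolding good_threshold_def m_def by linarith
      then show False using xs by simp
    qed
  qed simp
  also have "\<dots> \<le> ?P ?B1 + ?P ?B2"
    by (intro measure_Un_le) auto
  also have "?P ?B1 \<le> 5 * (2 / 10000)"
    using prob_exists_replicate_pmf_le[of 5 ?p "\<lambda>z. case z of (a, b, c) \<Rightarrow> min b c < \<theta>0"] low by simp
  also have "?P ?B2 \<le> (1 / 4) ^ 5"
    unfolding prob_all_replicate_pmf using prob_high_le by (intro power_mono) auto
  finally show ?thesis by (simp add: power_divide)
qed

end

section \<open>The two estimators in parallel\<close>

lemma first_decision_eq:
  assumes "t \<le> length zs" "dec (\<omega> @ take t zs) = Some r" "\<And>s. s < t \<Longrightarrow> dec (\<omega> @ take s zs) = None"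
  shows "first_decision dec \<omega> zs = Some r"
  using assms
proof (induction zs arbitrary: \<omega> t)
  case (Cons z zs)
  show ?case
  proof (cases t)
    case 0
    then show ?thesis using Cons.prems by simp
  next
    case (Suc t')
    have "dec \<omega> = None"
      using Cons.prems(3)[of 0] Suc by simp
    moreover have "first_decision dec (\<omega> @ [z]) zs = Some r"
      using Cons.prems(1,2) Cons.prems(3)[of "Suc s" for s] Suc by (intro Cons.IH[of t']) auto
    ultimately show ?thesis by simp
  qed
qed simp

text \<open>A union bound over two stages, with a uniform bound for the second stage on the good
  outcomes of the first.\<close>

lemma prob_bind_pmf_le:
  assumes "measure_pmf.prob p {x. \<not> Q x} \<le> a"
    and "\<And>x. x \<in> set_pmf p \<Longrightarrow> Q x \<Longrightarrow> measure_pmf.prob (f x) X \<le> b" and "0 \<le> b"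
  shows "measure_pmf.prob (bind_pmf p f) X \<le> a + b"
proof -
  have "measure_pmf.prob (bind_pmf p f) X \<le> measure_pmf.expectation p (\<lambda>x. indicator {x. \<not> Q x} x + b)"
    unfolding measure_bind_pmf
  proof (intro integral_mono_AE integrable_prob AE_pmfI)
    fix x assume "x \<in> set_pmf p"
    then show "measure_pmf.prob (f x) X \<le> indicator {x. \<not> Q x} x + b"
      using assms(2,3) by (cases "Q x") (auto intro: order.trans[OF measure_pmf.prob_le_1])
  qed (auto simp: integrable_real_indicator less_top[symmetric])
  also have "\<dots> = measure_pmf.prob p {x. \<not> Q x} + b"
    by (subst Bochner_Integration.integral_add) (auto simp: integrable_real_indicator less_top[symmetric])
  finally show ?thesis using assms(1) by simp
qed

text \<open>
  The constants allow failure probability 2/1000 each for the threshold, for the estimated fraction of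
  low edge ends, and for the two stopping times.
\<close>

definition stop_level :: "real \<Rightarrow> real" where
  "stop_level \<eta> = 1500 / \<eta>\<^sup>2"

definition fraction_samples :: "real \<Rightarrow> nat" where
  "fraction_samples \<eta> = nat \<lceil>5000000 / \<eta>\<^sup>2\<rceil>"

definition estimate_fraction :: "nat \<Rightarrow> (nat \<times> nat \<times> nat) list \<Rightarrow> real" where
  "estimate_fraction \<theta> ys = (\<Sum>z\<leftarrow>ys. low_value \<theta> z) / real (length ys)"

text \<open>After t samples the two sums are about t / d and t * \<phi> * d / \<theta>, where \<phi>
  approximates the low fraction. Equating either with the stopping level and solving for d gives the
  two outputs.\<close>

definition stopping_decision :: "real \<Rightarrow> nat \<Rightarrow> real \<Rightarrow> (nat \<times> nat \<times> nat) list \<Rightarrow> real option" where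
  "stopping_decision \<eta> \<theta> \<phi> zs =
    (if stop_level \<eta> \<le> (\<Sum>z\<leftarrow>zs. edge_value z) then Some (real (length zs) / stop_level \<eta>)
     else if stop_level \<eta> \<le> (\<Sum>z\<leftarrow>zs. vertex_value \<theta> z)
       then Some (stop_level \<eta> * real \<theta> / (real (length zs) * \<phi>))
     else None)"

text \<open>The three stages use disjoint samples, so the samples of a later stage keep their law
  whatever the earlier stages produced.\<close>

definition decision :: "real \<Rightarrow> (nat \<times> nat \<times> nat) list \<Rightarrow> real option" where
  "decision \<eta> \<omega> =
    (let k = fraction_samples \<eta>; \<theta> = threshold (take 5 \<omega>)
     in if length \<omega> < 5 + k then None
        else stopping_decision \<eta> \<theta> (estimate_fraction \<theta> (take k (drop 5 \<omega>))) (drop (5 + k) \<omega>))"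

section \<open>Accuracy and cost of the combined estimator\<close>

context
  fixes G :: graph and n m d \<eta> :: real
  assumes G: "input_graph G" and \<eta>: "0 < \<eta>" "\<eta> < 1 / 10"
  defines "n \<equiv> real (num_verts G)" and "m \<equiv> real (num_edges G)" and "d \<equiv> avg_deg G"
begin

lemmas bounds = n_m_pos[OF G, folded n_def m_def] avg_deg_eq[OF G, folded n_def m_def d_def]
  avg_deg_bounds[OF G, folded n_def d_def]

lemma stop_level: "0 < stop_level \<eta>" "1 \<le> \<eta> * stop_level \<eta>" "3 / (\<eta>\<^sup>2 * stop_level \<eta>) = 2 / 1000"
  using \<eta> by (auto simp: stop_level_def power2_eq_square field_simps)

lemma prob_bad_fraction:
  assumes "good_threshold G \<theta>"
  shows "measure_pmf.prob (replicate_pmf (fraction_samples \<eta>) (sample_pmf G))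
    {ys. \<not> \<bar>estimate_fraction \<theta> ys - low_fraction G \<theta>\<bar> \<le> \<eta> * low_fraction G \<theta>} \<le> 2 / 1000"
proof -
  define k where "k = fraction_samples \<eta>"
  define \<phi> where "\<phi> = low_fraction G \<theta>"
  let ?p = "sample_pmf G"
  have \<phi>: "1 / 10000 \<le> \<phi>"
    using assms by (simp add: good_threshold_def \<phi>_def)
  have k: "5000000 \<le> real k * \<eta>\<^sup>2"
  proof -
    have "5000000 / \<eta>\<^sup>2 \<le> real k"
      unfolding k_def fraction_samples_def by linarith
    then show ?thesis
      using \<eta> by (simp add: field_simps)
  qed
  then have "0 < k"
    by (cases k) auto
  have "measure_pmf.prob (replicate_pmf k ?p) {ys. \<not> \<bar>estimate_fraction \<theta> ys - \<phi>\<bar> \<le> \<eta> * \<phi>} \<le>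
      measure_pmf.prob (replicate_pmf k ?p)
        {ys. real k * \<eta> * \<phi> \<le> \<bar>(\<Sum>z\<leftarrow>ys. low_value \<theta> z) - real k * measure_pmf.expectation ?p (low_value \<theta>)\<bar>}"
  proof (intro measure_pmf.finite_measure_mono_AE AE_pmfI impI)
    fix ys assume ys: "ys \<in> set_pmf (replicate_pmf k ?p)"
      "ys \<in> {ys. \<not> \<bar>estimate_fraction \<theta> ys - \<phi>\<bar> \<le> \<eta> * \<phi>}"
    then have "(\<Sum>z\<leftarrow>ys. low_value \<theta> z) = real k * estimate_fraction \<theta> ys"
      using \<open>0 < k\<close> by (simp add: estimate_fraction_def set_replicate_pmf)
    then have "\<bar>(\<Sum>z\<leftarrow>ys. low_value \<theta> z) - real k * \<phi>\<bar> = real k * \<bar>estimate_fraction \<theta> ys - \<phi>\<bar>"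
      by (simp add: abs_mult flip: right_diff_distrib)
    moreover have "real k * (\<eta> * \<phi>) \<le> real k * \<bar>estimate_fraction \<theta> ys - \<phi>\<bar>"
      using ys by (intro mult_left_mono) auto
    ultimately show "ys \<in> {ys. real k * \<eta> * \<phi> \<le>
        \<bar>(\<Sum>z\<leftarrow>ys. low_value \<theta> z) - real k * measure_pmf.expectation ?p (low_value \<theta>)\<bar>}"
      by (simp add: expectation_low_value[OF G] \<phi>_def mult.assoc)
  qed simp
  also have "\<dots> \<le> real k * measure_pmf.variance ?p (low_value \<theta>) / (real k * \<eta> * \<phi>)\<^sup>2"
    using \<eta> \<phi> \<open>0 < k\<close> by (intro Chebyshev_replicate_pmf finite_sample_pmf[OF G]) auto
  also have "\<dots> \<le> real k * \<phi> / (real k * \<eta> * \<phi>)\<^sup>2"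
    using variance_le_expectation[OF finite_sample_pmf[OF G], of "low_value \<theta>"] sample_values_range(3)
    by (intro divide_right_mono mult_left_mono) (auto simp: expectation_low_value[OF G] \<phi>_def)
  also have "\<dots> = 1 / (real k * \<eta>\<^sup>2 * \<phi>)"
    using \<open>0 < k\<close> \<eta> \<phi> by (simp add: power2_eq_square)
  \<comment> \<open>The low fraction is at least 1/10000 by \<open>good_threshold\<close>, so the
    bound is 1/500 = 2/1000.\<close>
  also have "\<dots> \<le> 1 / (5000000 * (1 / 10000))"
    using k \<phi> by (intro divide_left_mono mult_mono) auto
  finally show ?thesis
    by (simp add: k_def \<phi>_def)
qed

text \<open>The stopping time contributes relative errors \<eta> and 2 * \<eta>, the estimated
  fraction another \<eta>; for \<eta> < 1/10 their combination stays within 10 * \<eta>.\<close>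

lemma decision_accurate:
  assumes \<theta>: "good_threshold G \<theta>" and \<phi>: "\<bar>\<phi> - low_fraction G \<theta>\<bar> \<le> \<eta> * low_fraction G \<theta>"
    and acc: "accurate_stop edge_value (1 / d) (stop_level \<eta>) \<eta> zs"
      "accurate_stop (vertex_value \<theta>) (low_fraction G \<theta> * d / real \<theta>) (stop_level \<eta>) \<eta> zs"
    and t: "t \<le> length zs" "stopping_decision \<eta> \<theta> \<phi> (take t zs) = Some r"
      "\<And>s. s < t \<Longrightarrow> stopping_decision \<eta> \<theta> \<phi> (take s zs) = None"
  shows "r \<in> eps_approx (10 * \<eta>) G"
proof -
  let ?U = "stop_level \<eta>"
  note d = bounds(4)
  define f where "f = low_fraction G \<theta>"
  have f: "0 < f" using \<theta> by (simp add: good_threshold_def f_def)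
  have \<phi>_bounds: "(1 - \<eta>) * f \<le> \<phi>" "\<phi> \<le> (1 + \<eta>) * f"
    using \<phi> by (auto simp: f_def algebra_simps abs_le_iff)
  have before: "(\<Sum>z\<leftarrow>take s zs. edge_value z) < ?U" "(\<Sum>z\<leftarrow>take s zs. vertex_value \<theta> z) < ?U"
    if "s < t" for s
    using t(3)[OF that] by (auto simp: stopping_decision_def split: if_splits)
  have "(1 - 10 * \<eta>) * d \<le> r \<and> r \<le> (1 + 10 * \<eta>) * d"
  proof (cases "?U \<le> (\<Sum>z\<leftarrow>take t zs. edge_value z)")
    case True
    then have "(1 - \<eta>) * ?U < real t * (1 / d)" "real t * (1 / d) \<le> (1 + 2 * \<eta>) * ?U"
      using acc(1) t(1) before unfolding accurate_stop_def by blast+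
    then have "(1 - \<eta>) * d \<le> real t / ?U" "real t / ?U \<le> (1 + 2 * \<eta>) * d"
      using d stop_level(1) by (simp_all add: field_simps)
    moreover have "r = real t / ?U"
      using t True by (simp add: stopping_decision_def)
    moreover have "(1 - 10 * \<eta>) * d \<le> (1 - \<eta>) * d" "(1 + 2 * \<eta>) * d \<le> (1 + 10 * \<eta>) * d"
      using d \<eta> by simp_all
    ultimately show ?thesis by linarith
  next
    case False
    then have U: "?U \<le> (\<Sum>z\<leftarrow>take t zs. vertex_value \<theta> z)" and r: "r = ?U * real \<theta> / (real t * \<phi>)"
      using t by (auto simp: stopping_decision_def split: if_splits)
    have "(1 - \<eta>) * ?U < real t * (f * d / real \<theta>)" "real t * (f * d / real \<theta>) \<le> (1 + 2 * \<eta>) * ?U"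
      using acc(2) t(1) U before unfolding accurate_stop_def f_def by blast+
    moreover have "0 < \<theta>"
      using \<theta> by (rule good_threshold_pos)
    ultimately have lo: "(1 - \<eta>) * (?U * real \<theta>) < real t * f * d"
      and hi: "real t * f * d \<le> (1 + 2 * \<eta>) * (?U * real \<theta>)"
      by (simp_all add: field_simps)
    let ?W = "?U * real \<theta>"
    have W: "0 < ?W"
      using stop_level(1) \<open>0 < \<theta>\<close> by simp
    have "0 < (1 - \<eta>) * ?W"
      using W \<eta> by simp
    then have "0 < real t * f * d"
      using lo by linarith
    then have tpos: "0 < real t"
      using f d by (simp add: zero_less_mult_iff)
    have \<phi>pos: "0 < \<phi>"
      using \<phi>_bounds(1) f \<eta> mult_pos_pos[of "1 - \<eta>" f] by linarith
    \<comment> \<open>Both bounds on \<open>r\<close> are proved after multiplication by the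
      positive denominator \<open>real t * \<phi>\<close>.\<close>
    have "(1 - 10 * \<eta>) * d * (real t * \<phi>) \<le> (1 - 10 * \<eta>) * d * (real t * ((1 + \<eta>) * f))"
      using \<phi>_bounds(2) d \<eta> tpos by (intro mult_left_mono) auto
    also have "\<dots> = (1 - 10 * \<eta>) * (1 + \<eta>) * (real t * f * d)"
      by (simp add: algebra_simps)
    also have "\<dots> \<le> (1 - 10 * \<eta>) * (1 + \<eta>) * ((1 + 2 * \<eta>) * ?W)"
      using hi \<eta> by (intro mult_left_mono) auto
    also have "\<dots> = ((1 - 10 * \<eta>) * (1 + \<eta>) * (1 + 2 * \<eta>)) * ?W"
      by (simp add: algebra_simps)
    also have "\<dots> \<le> 1 * ?W"
    proof (rule mult_right_mono)
      have "(1 - 10 * \<eta>) * (1 + \<eta>) * (1 + 2 * \<eta>) = 1 - (7 * \<eta> + 28 * (\<eta> * \<eta>) + 20 * (\<eta> * \<eta> * \<eta>))"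
        by (simp add: algebra_simps)
      moreover have "0 \<le> 7 * \<eta> + 28 * (\<eta> * \<eta>) + 20 * (\<eta> * \<eta> * \<eta>)"
        using \<eta> by (intro add_nonneg_nonneg mult_nonneg_nonneg) auto
      ultimately show "(1 - 10 * \<eta>) * (1 + \<eta>) * (1 + 2 * \<eta>) \<le> 1"
        by linarith
    qed (use W in simp)
    finally have lower: "(1 - 10 * \<eta>) * d \<le> r"
      unfolding r using tpos \<phi>pos by (simp add: pos_le_divide_eq)
    have "1 * ?W \<le> ((1 + 10 * \<eta>) * (1 - \<eta>) * (1 - \<eta>)) * ?W"
    proof (rule mult_right_mono)
      have "(1 + 10 * \<eta>) * (1 - \<eta>) * (1 - \<eta>) = 1 + \<eta> * (8 - 19 * \<eta>) + 10 * (\<eta> * \<eta> * \<eta>)"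
        by (simp add: algebra_simps)
      moreover have "0 \<le> \<eta> * (8 - 19 * \<eta>)" "0 \<le> \<eta> * \<eta> * \<eta>"
        using \<eta> by simp_all
      ultimately show "1 \<le> (1 + 10 * \<eta>) * (1 - \<eta>) * (1 - \<eta>)"
        by linarith
    qed (use W in simp)
    also have "\<dots> = (1 + 10 * \<eta>) * (1 - \<eta>) * ((1 - \<eta>) * ?W)"
      by (simp add: algebra_simps)
    also have "\<dots> \<le> (1 + 10 * \<eta>) * (1 - \<eta>) * (real t * f * d)"
      using lo \<eta> by (intro mult_left_mono) auto
    also have "\<dots> = (1 + 10 * \<eta>) * d * (real t * ((1 - \<eta>) * f))"
      by (simp add: algebra_simps)
    also have "\<dots> \<le> (1 + 10 * \<eta>) * d * (real t * \<phi>)"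
      using \<phi>_bounds(1) d \<eta> tpos by (intro mult_left_mono) auto
    finally have "r \<le> (1 + 10 * \<eta>) * d"
      unfolding r using tpos \<phi>pos by (simp add: pos_divide_le_eq)
    with lower show ?thesis ..
  qed
  then show ?thesis
    by (simp add: eps_approx_def d_def)
qed

text \<open>It remains to see that one rule fires within the sample. If \<open>d\<close> is the
  smaller term of the minimum, the edge sum reaches the level; otherwise the vertex sum does, its
  mean being at least d / (40000 * sqrt \<open>m\<close>).\<close>

lemma first_decision_accurate:
  assumes xs: "length xs = 5" and ys: "length ys = fraction_samples \<eta>"
    and \<theta>: "\<theta> = threshold xs" "good_threshold G \<theta>"
    and \<phi>: "\<bar>estimate_fraction \<theta> ys - low_fraction G \<theta>\<bar> \<le> \<eta> * low_fraction G \<theta>"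
    and acc: "accurate_stop edge_value (1 / d) (stop_level \<eta>) \<eta> zs"
      "accurate_stop (vertex_value \<theta>) (low_fraction G \<theta> * d / real \<theta>) (stop_level \<eta>) \<eta> zs"
    and T: "80000 * stop_level \<eta> * min d (sqrt (n / d)) \<le> real (length zs)"
  shows "first_decision (decision \<eta>) [] (xs @ ys @ zs) \<in> Some ` eps_approx (10 * \<eta>) G"
proof -
  let ?U = "stop_level \<eta>"
  define \<phi> where "\<phi> = estimate_fraction \<theta> ys"
  define stop where "stop = (\<lambda>t. stopping_decision \<eta> \<theta> \<phi> (take t zs))"
  have "?U \<le> (\<Sum>z\<leftarrow>zs. edge_value z) \<or> ?U \<le> (\<Sum>z\<leftarrow>zs. vertex_value \<theta> z)"
  proof (cases "d \<le> sqrt (n / d)")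
    case True
    have "(1 + 2 * \<eta>) * ?U \<le> 80000 * ?U"
      using \<eta> stop_level(1) by simp
    also have "\<dots> \<le> real (length zs) * (1 / d)"
      using T True bounds(4) by (simp add: min_absorb1 field_simps)
    finally show ?thesis
      using acc(1) by (simp add: accurate_stop_def)
  next
    case False
    have "0 < sqrt m" using bounds by simp
    have "low_fraction G \<theta> * d / real \<theta> \<ge> (1 / 10000) * d / (4 * sqrt m)" if "0 < \<theta>"
      using \<theta>(2) that bounds by (intro frac_le mult_right_mono mult_nonneg_nonneg) (auto simp: good_threshold_def m_def)
    moreover have "0 < \<theta>"
      using \<theta>(2) by (rule good_threshold_pos)
    ultimately have "d / (40000 * sqrt m) \<le> low_fraction G \<theta> * d / real \<theta>"
      by simp
    \<comment> \<open>The left side is sqrt (d * n) = sqrt (2 * \<open>m\<close>).\<close>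
    moreover have "d * sqrt (n / d) \<ge> sqrt m"
    proof -
      have "sqrt m \<le> sqrt (d * n)"
        using bounds by simp
      also have "d * n = d\<^sup>2 * (n / d)"
        using bounds(4) by (simp add: power2_eq_square)
      also have "sqrt \<dots> = d * sqrt (n / d)"
        using bounds(4) unfolding real_sqrt_mult by simp
      finally show ?thesis .
    qed
    \<comment> \<open>As 80000 = 2 * 40000, the expected sum is at least twice the level, which
      exceeds the required factor 1 + 2 * \<eta>.\<close>
    ultimately have *: "80000 * ?U * sqrt (n / d) * (d / (40000 * sqrt m)) \<ge> 2 * ?U"
      using \<open>0 < sqrt m\<close> stop_level(1) by (simp add: field_simps)
    have "(1 + 2 * \<eta>) * ?U \<le> 2 * ?U"
      using \<eta> stop_level(1) by simp
    also note *
    also have "80000 * ?U * sqrt (n / d) * (d / (40000 * sqrt m)) \<le>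
        real (length zs) * (low_fraction G \<theta> * d / real \<theta>)"
      using T False \<open>d / (40000 * sqrt m) \<le> low_fraction G \<theta> * d / real \<theta>\<close> bounds(1,2,4)
      by (intro mult_mono) (auto simp: min_absorb2)
    finally show ?thesis
      using acc(2) by (simp add: accurate_stop_def)
  qed
  then have "\<exists>t. t \<le> length zs \<and> stop t \<noteq> None"
    by (intro exI[of _ "length zs"]) (auto simp: stop_def stopping_decision_def)
  define t where "t = (LEAST t. t \<le> length zs \<and> stop t \<noteq> None)"
  have t: "t \<le> length zs" "stop t \<noteq> None"
    unfolding t_def using LeastI_ex[OF \<open>\<exists>t. t \<le> length zs \<and> stop t \<noteq> None\<close>] by blast+
  have before: "stop s = None" if "s < t" for s
    using not_less_Least[of s "\<lambda>t. t \<le> length zs \<and> stop t \<noteq> None"] that t(1) by (auto simp: t_def)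
  obtain r where r: "stop t = Some r" using t(2) by blast
  have "r \<in> eps_approx (10 * \<eta>) G"
    using decision_accurate[OF \<theta>(2) \<phi> acc t(1)] r before by (simp add: stop_def \<phi>_def)
  moreover have dec: "decision \<eta> (xs @ ys @ take s zs) = stop s" for s
    using xs ys by (simp add: decision_def stop_def \<phi>_def \<theta>(1) Let_def)
  have "first_decision (decision \<eta>) [] (xs @ ys @ zs) = Some r"
  proof (rule first_decision_eq[where t = "5 + fraction_samples \<eta> + t"])
    fix s assume s: "s < 5 + fraction_samples \<eta> + t"
    show "decision \<eta> ([] @ take s (xs @ ys @ zs)) = None"
    proof (cases "s < 5 + fraction_samples \<eta>")
      case True
      then have "length (take s (xs @ ys @ zs)) < 5 + fraction_samples \<eta>"
        by simp
      then show ?thesis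
        unfolding decision_def Let_def append_Nil by (rule if_P)
    next
      case False
      then have "take s (xs @ ys @ zs) = xs @ ys @ take (s - 5 - fraction_samples \<eta>) zs"
        using xs ys by simp
      then show ?thesis
        using dec before s False by simp
    qed
  qed (use xs ys t r dec in simp_all)
  ultimately show ?thesis by simp
qed

lemma prob_first_decision:
  assumes T: "80000 * stop_level \<eta> * min d (sqrt (n / d)) \<le> real T"
  shows "99 / 100 \<le> measure_pmf.prob
    (map_pmf (first_decision (decision \<eta>) []) (replicate_pmf (5 + (fraction_samples \<eta> + T)) (sample_pmf G)))
    (Some ` eps_approx (10 * \<eta>) G)"
proof -
  let ?p = "sample_pmf G" and ?S = "Some ` eps_approx (10 * \<eta>) G"
  let ?good = "\<lambda>\<theta> zs. accurate_stop edge_value (1 / d) (stop_level \<eta>) \<eta> zs \<and>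
      accurate_stop (vertex_value \<theta>) (low_fraction G \<theta> * d / real \<theta>) (stop_level \<eta>) \<eta> zs"
  let ?bad = "first_decision (decision \<eta>) [] -` (- ?S)"
  have zs: "measure_pmf.prob (replicate_pmf T ?p) {zs. \<not> ?good \<theta> zs} \<le> 4 / 1000"
    if "good_threshold G \<theta>" for \<theta>
  proof -
    have "0 < \<theta>"
      using that by (rule good_threshold_pos)
    have "0 < low_fraction G \<theta>"
      using that by (simp add: good_threshold_def)
    have "measure_pmf.prob (replicate_pmf T ?p) {zs. \<not> ?good \<theta> zs} \<le>
        measure_pmf.prob (replicate_pmf T ?p) ({zs. \<not> accurate_stop edge_value (1 / d) (stop_level \<eta>) \<eta> zs} \<union>
          {zs. \<not> accurate_stop (vertex_value \<theta>) (low_fraction G \<theta> * d / real \<theta>) (stop_level \<eta>) \<eta> zs})"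
      by (intro measure_pmf.finite_measure_mono) auto
    also have "\<dots> \<le> 2 / 1000 + 2 / 1000"
    proof (intro order.trans[OF measure_Un_le add_mono])
      show "measure_pmf.prob (replicate_pmf T ?p) {zs. \<not> accurate_stop edge_value (1 / d) (stop_level \<eta>) \<eta> zs} \<le> 2 / 1000"
        unfolding stop_level(3)[symmetric] using bounds(4) \<eta> stop_level
        by (intro prob_accurate_stop finite_sample_pmf[OF G] sample_values_range)
           (auto simp: expectation_edge_value[OF G] d_def)
      show "measure_pmf.prob (replicate_pmf T ?p)
          {zs. \<not> accurate_stop (vertex_value \<theta>) (low_fraction G \<theta> * d / real \<theta>) (stop_level \<eta>) \<eta> zs} \<le> 2 / 1000"
        unfolding stop_level(3)[symmetric] using bounds(4) \<eta> stop_level \<open>0 < \<theta>\<close> \<open>0 < low_fraction G \<theta>\<close>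
        by (intro prob_accurate_stop finite_sample_pmf[OF G] sample_values_range)
           (auto simp: expectation_vertex_value[OF G] d_def)
    qed auto
    finally show ?thesis by simp
  qed
  \<comment> \<open>The failure probabilities of the three stages add up to 8/1000.\<close>
  have "measure_pmf.prob (replicate_pmf (5 + (fraction_samples \<eta> + T)) ?p) ?bad \<le> 2 / 1000 + (2 / 1000 + (4 / 1000 + 0))"
    unfolding replicate_pmf_distrib bind_assoc_pmf bind_return_pmf
  proof (rule prob_bind_pmf_le[OF prob_bad_threshold[OF G]])
    fix xs assume xs: "xs \<in> set_pmf (replicate_pmf 5 ?p)" "good_threshold G (threshold xs)"
    show "measure_pmf.prob (replicate_pmf (fraction_samples \<eta>) ?p \<bind> (\<lambda>ys. replicate_pmf T ?p \<bind>
        (\<lambda>zs. return_pmf (xs @ ys @ zs)))) ?bad \<le> 2 / 1000 + (4 / 1000 + 0)"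
    proof (rule prob_bind_pmf_le[OF prob_bad_fraction[OF xs(2)]])
      fix ys assume ys: "ys \<in> set_pmf (replicate_pmf (fraction_samples \<eta>) ?p)"
        "\<bar>estimate_fraction (threshold xs) ys - low_fraction G (threshold xs)\<bar> \<le> \<eta> * low_fraction G (threshold xs)"
      show "measure_pmf.prob (replicate_pmf T ?p \<bind> (\<lambda>zs. return_pmf (xs @ ys @ zs))) ?bad \<le> 4 / 1000 + 0"
      proof (rule prob_bind_pmf_le[OF zs[OF xs(2)]])
        fix zs assume "zs \<in> set_pmf (replicate_pmf T ?p)" "?good (threshold xs) zs"
        then have "xs @ ys @ zs \<notin> ?bad"
          using first_decision_accurate[OF _ _ refl xs(2) ys(2), of zs] xs(1) ys(1) T
          by (simp add: set_replicate_pmf del: replicate_pmf.simps)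
        then show "measure_pmf.prob (return_pmf (xs @ ys @ zs)) ?bad \<le> 0"
          by simp
      qed simp
    qed simp
  qed simp
  then have "measure_pmf.prob (replicate_pmf (5 + (fraction_samples \<eta> + T)) ?p) ?bad \<le> 1 / 100"
    by simp
  moreover have "?bad = UNIV - first_decision (decision \<eta>) [] -` ?S"
    by auto
  ultimately show ?thesis
    using measure_pmf.prob_compl[of "first_decision (decision \<eta>) [] -` ?S"
        "replicate_pmf (5 + (fraction_samples \<eta> + T)) ?p"]
    by (simp del: replicate_pmf.simps)
qed

text \<open>Both \<open>d\<close> and \<open>n / d\<close> are at least 1, so the minimum is at
  least 1 and the fixed cost of the first two stages is absorbed by the bound for the third.\<close>

lemma sampling_algorithm_correct:
  assumes q: "1000000000 * stop_level \<eta> * min d (sqrt (n / d)) \<le> q"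
  shows "outputs_in_using (sampling_algorithm (decision \<eta>)) G (eps_approx (10 * \<eta>) G) q"
proof -
  define w where "w = stop_level \<eta> * min d (sqrt (n / d))"
  define T where "T = nat \<lceil>80000 * w\<rceil>"
  have "1 \<le> sqrt (n / d)"
    using bounds(4,5) by simp
  then have min1: "1 \<le> min d (sqrt (n / d))"
    using bounds(4) by simp
  have "1 \<le> stop_level \<eta>"
    using \<eta> mult_mono[of \<eta> 1 \<eta> 1] by (simp add: stop_level_def power2_eq_square)
  then have w: "1 \<le> w" "stop_level \<eta> \<le> w"
    using mult_left_mono[OF min1, of "stop_level \<eta>"] unfolding w_def by linarith+
  have "real T \<le> 80000 * w + 1"
    unfolding T_def using w by linarith
  moreover have "real (fraction_samples \<eta>) \<le> 5000000 / \<eta>\<^sup>2 + 1"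
  proof -
    have "0 \<le> 5000000 / \<eta>\<^sup>2" by simp
    then show ?thesis unfolding fraction_samples_def by linarith
  qed
  moreover have "5000000 / \<eta>\<^sup>2 \<le> 5000 * stop_level \<eta>"
    by (simp add: stop_level_def divide_right_mono)
  ultimately have "real (5 * (5 + (fraction_samples \<eta> + T))) \<le> 1000000000 * w"
    using w by simp
  also have "\<dots> \<le> q"
    using q by (simp add: w_def mult.assoc)
  finally have "real (5 * (5 + (fraction_samples \<eta> + T))) \<le> q" .
  moreover have "80000 * stop_level \<eta> * min d (sqrt (n / d)) \<le> real T"
    unfolding T_def w_def by (simp add: mult.assoc) linarith
  ultimately show ?thesis
    unfolding outputs_in_using_def prob_within_def
    using prob_first_decision[of T] run_sampling_algorithm[OF G, of "[]" "decision \<eta>" "5 + (fraction_samples \<eta> + T)"]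
    by (intro exI[of _ "5 * (5 + (fraction_samples \<eta> + T))"])
       (simp del: replicate_pmf.simps measure_map_pmf mult_Suc_right distrib_left_numeral of_nat_add of_nat_mult)
qed

end

section \<open>A clique with a matching\<close>

definition clique_edges :: "nat \<Rightarrow> nat set set" where
  "clique_edges k = {e. e \<subseteq> {..<k} \<and> card e = 2}"

definition pair_vertex :: "nat \<Rightarrow> nat \<times> nat \<Rightarrow> nat" where
  "pair_vertex k = (\<lambda>(j, b). k + 2 * j + b)"

definition hard_graph :: "nat \<Rightarrow> nat set \<Rightarrow> graph" where
  "hard_graph k S = \<lparr>verts = {..<k} \<union> pair_vertex k ` (S \<times> {0, 1}),
    edges = clique_edges k \<union> (\<lambda>j. {pair_vertex k (j, 0), pair_vertex k (j, 1)}) ` S\<rparr>"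

text \<open>Membership in the vertex set, phrased by the index of the pair so that it depends on a
  single element of \<open>S\<close>. The first disjunct also guards the truncated
  subtraction.\<close>

definition known :: "nat \<Rightarrow> nat set \<Rightarrow> nat \<Rightarrow> bool" where
  "known k S x \<longleftrightarrow> x < k \<or> (x - k) div 2 \<in> S"

lemma known_iff: "known k S x \<longleftrightarrow> x \<in> verts (hard_graph k S)"
proof
  assume x: "known k S x"
  show "x \<in> verts (hard_graph k S)"
  proof (cases "x < k")
    case False
    then have "x = pair_vertex k ((x - k) div 2, (x - k) mod 2)"
      by (simp add: pair_vertex_def)
    then show ?thesis
      using x False by (auto simp: known_def hard_graph_def intro!: image_eqI[of x _ "((x - k) div 2, (x - k) mod 2)"])
  qed (simp add: hard_graph_def)
qed (auto simp: known_def hard_graph_def pair_vertex_def)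

lemma clique_edge_iff: "{x, y} \<in> clique_edges k \<longleftrightarrow> x < k \<and> y < k \<and> x \<noteq> y"
  by (cases "x = y") (auto simp: clique_edges_def)

lemma hard_graph_edge_iff:
  "{x, y} \<in> edges (hard_graph k S) \<longleftrightarrow> x < k \<and> y < k \<and> x \<noteq> y \<or>
    (\<exists>j\<in>S. x = k + 2 * j \<and> y = k + 2 * j + 1 \<or> x = k + 2 * j + 1 \<and> y = k + 2 * j)"
  by (simp add: hard_graph_def clique_edge_iff pair_vertex_def image_iff doubleton_eq_iff)

text \<open>A neighbourhood lies inside the clique or inside one pair. Queries about a revealed
  vertex, full neighbourhoods included, thus have the same answers in all matchings that extend
  \<open>K\<close>.\<close>

lemma nbrs_hard_graph_mono:
  assumes "K \<subseteq> S" "known k K x"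
  shows "nbrs (hard_graph k S) x = nbrs (hard_graph k K) x"
  using assms by (auto simp: nbrs_def hard_graph_edge_iff known_def)

lemma inj_on_pair_vertex: "inj_on (pair_vertex k) (S \<times> {0, 1})"
  by (auto simp: inj_on_def pair_vertex_def) presburger+

lemma finite_clique_edges: "finite (clique_edges k)"
  unfolding clique_edges_def by (rule finite_subset[of _ "Pow {..<k}"]) auto

lemma card_clique_edges: "card (clique_edges k) = k choose 2"
  unfolding clique_edges_def using n_subsets[of "{..<k}" 2] by simp

lemma num_verts_hard_graph:
  assumes "finite S"
  shows "num_verts (hard_graph k S) = k + 2 * card S"
proof -
  have "card (pair_vertex k ` (S \<times> {0, 1})) = 2 * card S"
    by (subst card_image[OF inj_on_pair_vertex]) (simp add: card_cartesian_product)
  moreover have "{..<k} \<inter> pair_vertex k ` (S \<times> {0, 1}) = {}"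
    by (auto simp: pair_vertex_def)
  ultimately show ?thesis
    using assms by (simp add: num_verts_def hard_graph_def card_Un_disjoint)
qed

lemma num_edges_hard_graph:
  assumes "finite S"
  shows "num_edges (hard_graph k S) = (k choose 2) + card S"
proof -
  have "inj_on (\<lambda>j. {pair_vertex k (j, 0), pair_vertex k (j, 1)}) S"
    by (auto simp: inj_on_def pair_vertex_def doubleton_eq_iff)
  moreover have "clique_edges k \<inter> (\<lambda>j. {pair_vertex k (j, 0), pair_vertex k (j, 1)}) ` S = {}"
    by (auto simp: clique_edge_iff pair_vertex_def)
  ultimately show ?thesis
    unfolding num_edges_def hard_graph_def using assms
    by (simp add: card_Un_disjoint finite_clique_edges card_clique_edges card_image)
qed

lemma input_graph_hard_graph:
  assumes "finite S" "2 \<le> k"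
  shows "input_graph (hard_graph k S)"
proof -
  have fin: "finite (verts (hard_graph k S))" "verts (hard_graph k S) \<noteq> {}"
    using assms by (auto simp: hard_graph_def lessThan_empty_iff)
  have "\<exists>u\<in>verts (hard_graph k S). \<exists>v\<in>verts (hard_graph k S). u \<noteq> v \<and> e = {u, v}"
    if e: "e \<in> edges (hard_graph k S)" for e
  proof -
    consider "e \<in> clique_edges k" | j where "j \<in> S" "e = {pair_vertex k (j, 0), pair_vertex k (j, 1)}"
      using e by (auto simp: hard_graph_def)
    then show ?thesis
    proof cases
      case 1
      then obtain u v where "e = {u, v}" "u \<noteq> v"
        by (auto simp: clique_edges_def card_2_iff)
      with 1 show ?thesis
        by (intro bexI[of _ u] bexI[of _ v]) (auto simp: hard_graph_def clique_edges_def)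
    next
      case 2
      have "pair_vertex k (j, b) \<in> verts (hard_graph k S)" if "b \<in> {0, 1}" for b
        using that \<open>j \<in> S\<close> by (auto simp: hard_graph_def)
      moreover have "pair_vertex k (j, 0) \<noteq> pair_vertex k (j, 1)"
        by (simp add: pair_vertex_def)
      ultimately show ?thesis
        using 2(2) by blast
    qed
  qed
  then have simple: "simple_graph (hard_graph k S)"
    using fin by (simp add: simple_graph_def)
  have "nbrs (hard_graph k S) x \<noteq> {}" if x: "x \<in> verts (hard_graph k S)" for x
  proof (cases "x < k")
    case True
    then have "(if x = 0 then 1 else 0) \<in> nbrs (hard_graph k S) x"
      using assms by (auto simp: nbrs_def hard_graph_edge_iff)
    then show ?thesis by blast
  next
    case False
    then obtain j where "j \<in> S" "x = k + 2 * j \<or> x = k + 2 * j + 1"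
      using x by (auto simp: hard_graph_def pair_vertex_def)
    then have "k + 2 * j + 1 \<in> nbrs (hard_graph k S) x \<or> k + 2 * j \<in> nbrs (hard_graph k S) x"
      by (auto simp: nbrs_def hard_graph_edge_iff)
    then show ?thesis by blast
  qed
  moreover have "finite (nbrs (hard_graph k S) x)" for x
    using simple by (rule finite_nbrs)
  ultimately show ?thesis
    using simple by (simp add: input_graph_def no_isolated_def deg_def card_gt_0_iff)
qed

text \<open>
  In the ideal process the matching is sampled lazily: \<open>K\<close> holds the indices of the pairs revealed so
  far, \<open>Z\<close> the guessed indices declared not to occur.  Neither depends on the size of the matching.
\<close>

definition ideal_vertex_answer ::
  "nat \<Rightarrow> nat set \<Rightarrow> nat set \<Rightarrow> oracle_query \<Rightarrow> nat \<Rightarrow> (answer \<times> nat set \<times> nat set) pmf" where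
  "ideal_vertex_answer k K Z q x =
    (if known k K x then map_pmf (\<lambda>y. (y, K, Z)) (answer_pmf (hard_graph k K) q)
     else return_pmf (Invalid, K, insert ((x - k) div 2) Z))"

primrec ideal_answer ::
  "nat \<Rightarrow> nat \<Rightarrow> nat set \<Rightarrow> nat set \<Rightarrow> oracle_query \<Rightarrow> (answer \<times> nat set \<times> nat set) pmf" where
  "ideal_answer k M K Z RandVert =
    map_pmf (\<lambda>v. (Vertex (pair_vertex k v), insert (fst v) K, Z)) (pmf_of_set (({..<M} - Z - K) \<times> {0, 1}))"
| "ideal_answer k M K Z RandEdge = map_pmf (\<lambda>e. (Edge e, K, Z)) (pmf_of_set (clique_edges k))"
| "ideal_answer k M K Z (RandNbr x) = ideal_vertex_answer k K Z (RandNbr x) x"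
| "ideal_answer k M K Z (Degree x) = ideal_vertex_answer k K Z (Degree x) x"
| "ideal_answer k M K Z (FullNbrHood x) = ideal_vertex_answer k K Z (FullNbrHood x) x"

primrec ideal_run ::
  "algorithm \<Rightarrow> nat \<Rightarrow> nat \<Rightarrow> nat \<Rightarrow> nat set \<Rightarrow> nat set \<Rightarrow> history \<Rightarrow> real option pmf" where
  "ideal_run A k M 0 K Z h = bind_pmf (A h) (\<lambda>a. case a of
       Return r \<Rightarrow> return_pmf (Some r)
     | Ask q \<Rightarrow> return_pmf None)"
| "ideal_run A k M (Suc t) K Z h = bind_pmf (A h) (\<lambda>a. case a of
       Return r \<Rightarrow> return_pmf (Some r)
     | Ask q \<Rightarrow> bind_pmf (ideal_answer k M K Z q)
         (\<lambda>(y, K', Z'). ideal_run A k M t K' Z' (h @ [(q, y)])))"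

section \<open>Counting the matchings compatible with the revealed information\<close>

definition extensions :: "nat \<Rightarrow> nat \<Rightarrow> nat set \<Rightarrow> nat set \<Rightarrow> nat set set" where
  "extensions M N K Z = {S. S \<subseteq> {..<M} - Z \<and> K \<subseteq> S \<and> card S = N}"

lemma finite_extensions: "finite (extensions M N K Z)"
  unfolding extensions_def by (rule finite_subset[of _ "Pow {..<M}"]) auto

lemma card_extensions:
  assumes "K \<subseteq> {..<M} - Z" "card K \<le> N"
  shows "card (extensions M N K Z) = card ({..<M} - Z - K) choose (N - card K)"
proof -
  have finK: "finite K" using assms(1) finite_subset by blast
  have "bij_betw (\<lambda>S. S - K) (extensions M N K Z) {B. B \<subseteq> {..<M} - Z - K \<and> card B = N - card K}"
  proof (rule bij_betw_byWitness[where f' = "\<lambda>B. B \<union> K"])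
    show "(\<lambda>S. S - K) ` extensions M N K Z \<subseteq> {B. B \<subseteq> {..<M} - Z - K \<and> card B = N - card K}"
      using finK by (auto simp: extensions_def card_Diff_subset)
    show "(\<lambda>B. B \<union> K) ` {B. B \<subseteq> {..<M} - Z - K \<and> card B = N - card K} \<subseteq> extensions M N K Z"
    proof safe
      fix B assume B: "B \<subseteq> {..<M} - Z - K" "card B = N - card K"
      then have "finite B" "B \<inter> K = {}" using finite_subset by blast+
      then show "B \<union> K \<in> extensions M N K Z"
        using B assms finK by (auto simp: extensions_def card_Un_disjoint)
    qed
  qed (auto simp: extensions_def)
  then show ?thesis
    by (simp add: bij_betw_same_card n_subsets)
qed

text \<open>In a uniformly random extension an open index occurs with probability
  \<open>N - card K\<close> over the number of open indices. Cleared of denominators this is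
  binomial absorption.\<close>

lemma card_extensions_insert_revealed:
  assumes "K \<subseteq> {..<M} - Z" "card K < N" "j \<in> {..<M} - Z - K"
  shows "card ({..<M} - Z - K) * card (extensions M N (insert j K) Z) =
    (N - card K) * card (extensions M N K Z)"
proof -
  have finK: "finite K" using assms(1) finite_subset by blast
  have "card (insert j K) = Suc (card K)"
    using assms finK by simp
  moreover have "card ({..<M} - Z - insert j K) = card ({..<M} - Z - K) - 1"
    using assms(3) by (metis Diff_insert card_Diff_singleton)
  ultimately show ?thesis
    using assms binomial_absorption[of "N - card K - 1" "card ({..<M} - Z - K)"]
    by (simp add: card_extensions Suc_diff_Suc del: binomial_Suc_Suc)
qed

text \<open>The complementary probability, that an open index does not occur.\<close>

lemma card_extensions_insert_excluded:
  assumes "K \<subseteq> {..<M} - Z" "card K \<le> N" "j \<in> {..<M} - Z - K"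
  shows "card ({..<M} - Z - K) * card (extensions M N K (insert j Z)) =
    (card ({..<M} - Z - K) - (N - card K)) * card (extensions M N K Z)"
proof -
  have "card ({..<M} - insert j Z - K) = card ({..<M} - Z - K) - 1"
    using assms(3) by (metis Diff_insert Diff_insert2 card_Diff_singleton)
  moreover have "K \<subseteq> {..<M} - insert j Z"
    using assms by blast
  ultimately show ?thesis
    using assms binomial_absorb_comp[of "card ({..<M} - Z - K)" "N - card K"]
    by (simp add: card_extensions)
qed

text \<open>Double counting of an extension with one of its unrevealed pairs: the extensions
  containing \<open>j\<close> are those of \<open>insert j K\<close>.\<close>

lemma sum_extensions_swap:
  fixes g :: "nat set \<Rightarrow> nat \<Rightarrow> real"
  assumes "K \<subseteq> {..<M} - Z"
  shows "(\<Sum>S\<in>extensions M N K Z. \<Sum>j\<in>S - K. g S j) =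
    (\<Sum>j\<in>{..<M} - Z - K. \<Sum>S\<in>extensions M N (insert j K) Z. g S j)"
proof -
  have "(\<Sum>S\<in>extensions M N K Z. \<Sum>j\<in>S - K. g S j) =
      (\<Sum>S\<in>extensions M N K Z. \<Sum>j | j \<in> {..<M} - Z - K \<and> j \<in> S. g S j)"
    by (intro sum.cong refl) (auto simp: extensions_def)
  also have "\<dots> = (\<Sum>j\<in>{..<M} - Z - K. \<Sum>S | S \<in> extensions M N K Z \<and> j \<in> S. g S j)"
    by (rule sum.swap_restrict) (auto simp: finite_extensions)
  also have "\<dots> = (\<Sum>j\<in>{..<M} - Z - K. \<Sum>S\<in>extensions M N (insert j K) Z. g S j)"
    by (intro sum.cong refl) (auto simp: extensions_def)
  finally show ?thesis .
qed

section \<open>Comparison with the ideal process\<close>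

lemma expectation_mono_scaled:
  fixes c :: real
  assumes "\<And>x. c * measure_pmf.prob (f x) R \<le> (\<Sum>S\<in>F. measure_pmf.prob (g S x) R)"
  shows "c * measure_pmf.prob (bind_pmf p f) R \<le> (\<Sum>S\<in>F. measure_pmf.prob (bind_pmf p (g S)) R)"
proof -
  have "c * measure_pmf.prob (bind_pmf p f) R = measure_pmf.expectation p (\<lambda>x. c * measure_pmf.prob (f x) R)"
    by (simp add: measure_bind_pmf)
  also have "\<dots> \<le> measure_pmf.expectation p (\<lambda>x. \<Sum>S\<in>F. measure_pmf.prob (g S x) R)"
    using assms
    by (intro integral_mono integrable_mult_right Bochner_Integration.integrable_sum integrable_prob) auto
  also have "\<dots> = (\<Sum>S\<in>F. measure_pmf.prob (bind_pmf p (g S)) R)"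
    by (simp add: measure_bind_pmf integrable_prob Bochner_Integration.integral_sum)
  finally show ?thesis .
qed

text \<open>Here \<open>p\<close> bounds the chance that one real answer departs from the ideal one:
  a random vertex outside the fresh pairs, a random edge outside the clique, a guess that hits a
  pair. \<open>N - T\<close> and \<open>M - T\<close> allow for up to \<open>T\<close> indices
  already revealed or excluded.\<close>

context
  fixes k M N T :: nat and p :: real and A :: algorithm and R :: "real option set"
  assumes k: "2 \<le> k" and T: "T < N" "N + T \<le> M" and p: "0 \<le> p" "p \<le> 1"
    and p_vertex: "1 - p \<le> 2 * real (N - T) / real (k + 2 * N)"
    and p_edge: "1 - p \<le> real (k choose 2) / real ((k choose 2) + N)"
    and p_guess: "real N \<le> p * real (M - T)"
begin

abbreviation "ideal_prob t K Z h \<equiv> measure_pmf.prob (ideal_run A k M t K Z h) R"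
abbreviation "graph_prob S t h \<equiv> measure_pmf.prob (run A (hard_graph k S) t h) R"

text \<open>
  Both sides are multiplied by the number of extensions, i.e. the run on a graph is averaged over the
  matchings that agree with the answers given so far.
\<close>

definition dominates :: "nat \<Rightarrow> nat set \<Rightarrow> nat set \<Rightarrow> history \<Rightarrow> bool" where
  "dominates t K Z h \<longleftrightarrow> (1 - p) ^ t * real (card (extensions M N K Z)) * ideal_prob t K Z h \<le>
    (\<Sum>S\<in>extensions M N K Z. graph_prob S t h)"

text \<open>A query reveals or excludes at most one index, so the budget \<open>T\<close> covers the
  indices already fixed and the \<open>t\<close> queries still to come.\<close>

definition valid_state :: "nat \<Rightarrow> nat set \<Rightarrow> nat set \<Rightarrow> bool" where
  "valid_state t K Z \<longleftrightarrow> finite Z \<and> K \<subseteq> {..<M} - Z \<and> card K + card Z + t \<le> T"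

lemma valid_state_facts:
  assumes "valid_state t K Z"
  shows "finite K" "card K + t \<le> T" "card ({..<M} - Z - K) \<ge> M - T" "card ({..<M} - Z - K) > 0"
proof -
  show fin: "finite K"
    using assms finite_subset by (fastforce simp: valid_state_def)
  show "card K + t \<le> T"
    using assms by (simp add: valid_state_def)
  have eq: "{..<M} - (Z \<union> K) = {..<M} - Z - K"
    by blast
  have "M - (card Z + card K) \<le> card ({..<M} - Z - K)"
    using assms fin diff_card_le_card_Diff[of "Z \<union> K" "{..<M}"] card_Un_le[of Z K]
    by (simp add: valid_state_def eq)
  then show *: "card ({..<M} - Z - K) \<ge> M - T"
    using assms unfolding valid_state_def by linarith
  show "card ({..<M} - Z - K) > 0"
    using * T by linarith
qed

lemma shrink: "(1 - p) ^ Suc t * real c * x \<le> (1 - p) ^ t * real c * x" if "0 \<le> x" for t c and x :: real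
proof -
  have "(1 - p) ^ Suc t \<le> (1 - p) ^ t"
    using p by (intro power_decreasing) auto
  then show ?thesis
    using that by (intro mult_right_mono) auto
qed

context
  fixes t :: nat and K Z :: "nat set" and h :: history
  assumes state: "valid_state (Suc t) K Z"
    and IH: "\<And>K' Z' h'. valid_state t K' Z' \<Longrightarrow> dominates t K' Z' h'"
begin

lemma valid_state_Suc: "valid_state t K Z"
  using state by (simp add: valid_state_def)

lemma K_less: "card K < N"
  using valid_state_facts(2)[OF state] T by linarith

lemma finite_extension: "S \<in> extensions M N K Z \<Longrightarrow> finite S"
  by (auto simp: extensions_def intro: finite_subset[of S "{..<M} - Z"])

text \<open>Equal answer laws lose nothing; the factor \<open>1 - p\<close> of this step is given
  away by \<open>shrink\<close>.\<close>

lemma step_known_answers: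
  assumes "\<And>S. S \<in> extensions M N K Z \<Longrightarrow> answer_pmf (hard_graph k S) q = r"
  shows "(1 - p) ^ Suc t * real (card (extensions M N K Z)) *
      measure_pmf.prob (bind_pmf r (\<lambda>y. ideal_run A k M t K Z (h @ [(q, y)]))) R \<le>
    (\<Sum>S\<in>extensions M N K Z. measure_pmf.prob (bind_pmf (answer_pmf (hard_graph k S) q)
      (\<lambda>y. run A (hard_graph k S) t (h @ [(q, y)]))) R)"
proof -
  have "(1 - p) ^ Suc t * real (card (extensions M N K Z)) *
      measure_pmf.prob (bind_pmf r (\<lambda>y. ideal_run A k M t K Z (h @ [(q, y)]))) R \<le>
    (\<Sum>S\<in>extensions M N K Z. measure_pmf.prob (bind_pmf r
      (\<lambda>y. run A (hard_graph k S) t (h @ [(q, y)]))) R)"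
  proof (rule expectation_mono_scaled)
    fix y
    show "(1 - p) ^ Suc t * real (card (extensions M N K Z)) * ideal_prob t K Z (h @ [(q, y)]) \<le>
        (\<Sum>S\<in>extensions M N K Z. graph_prob S t (h @ [(q, y)]))"
      using IH[OF valid_state_Suc, of "h @ [(q, y)]"] unfolding dominates_def
      by (rule order.trans[OF shrink[OF measure_nonneg]])
  qed
  then show ?thesis
    using assms by simp
qed

text \<open>At least a fraction \<open>1 - p\<close> of the extensions avoid the guessed pair and
  answer \<open>Invalid\<close> as the ideal process does. The others contribute nonnegative
  terms.\<close>

lemma step_guess:
  assumes x: "\<not> known k K x" and q: "\<And>S. \<not> known k S x \<Longrightarrow> answer_pmf (hard_graph k S) q = return_pmf Invalid"
  shows "(1 - p) ^ Suc t * real (card (extensions M N K Z)) *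
      ideal_prob t K (insert ((x - k) div 2) Z) (h @ [(q, Invalid)]) \<le>
    (\<Sum>S\<in>extensions M N K Z. measure_pmf.prob (bind_pmf (answer_pmf (hard_graph k S) q)
      (\<lambda>y. run A (hard_graph k S) t (h @ [(q, y)]))) R)"
proof -
  define j where "j = (x - k) div 2"
  define W where "W = {..<M} - Z - K"
  have j: "\<not> known k S x \<longleftrightarrow> j \<notin> S" for S
    using x by (auto simp: known_def j_def)
  have fin: "finite Z" and KZ: "K \<subseteq> {..<M} - Z"
    using state by (auto simp: valid_state_def)
  have valid: "valid_state t K (insert j Z)"
  proof -
    have "j \<notin> K" using x j by simp
    then show ?thesis
      using state card_insert_le_m1[of "Suc (card Z)" Z j] fin card_insert_if[OF fin, of j]
      by (auto simp: valid_state_def)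
  qed
  have card_le: "(1 - p) * real (card (extensions M N K Z)) \<le> real (card (extensions M N K (insert j Z)))"
  proof (cases "j \<in> W")
    \<comment> \<open>The index is out of range or already excluded, so no extension is
      lost.\<close>
    case False
    then have "extensions M N K (insert j Z) = extensions M N K Z"
      using x j by (auto simp: extensions_def W_def)
    then show ?thesis
      using p by (simp add: mult_left_le_one_le)
  next
    case True
    let ?a = "real (card W)"
    have a: "M - T \<le> card W" "0 < card W"
      using valid_state_facts(3,4)[OF state] by (simp_all add: W_def)
    then have "real N \<le> p * ?a"
      using p_guess p mult_left_mono[of "real (M - T)" ?a p] by linarith
    moreover have "?a - real N \<le> real (card W - (N - card K))"
      by linarith
    ultimately have "(1 - p) * ?a \<le> real (card W - (N - card K))"
      by (simp add: algebra_simps)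
    then have "((1 - p) * ?a) * real (card (extensions M N K Z)) \<le>
        real (card W - (N - card K)) * real (card (extensions M N K Z))"
      by (rule mult_right_mono) simp
    also have "\<dots> = ?a * real (card (extensions M N K (insert j Z)))"
      using card_extensions_insert_excluded[OF KZ less_imp_le[OF K_less] True[unfolded W_def]]
      by (simp add: W_def flip: of_nat_mult)
    finally have "?a * ((1 - p) * real (card (extensions M N K Z))) \<le>
        ?a * real (card (extensions M N K (insert j Z)))"
      by (simp add: mult_ac)
    then show ?thesis
      using a(2) by simp
  qed
  have "(1 - p) ^ Suc t * real (card (extensions M N K Z)) * ideal_prob t K (insert j Z) (h @ [(q, Invalid)]) =
      ((1 - p) ^ t * ideal_prob t K (insert j Z) (h @ [(q, Invalid)])) * ((1 - p) * real (card (extensions M N K Z)))"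
    by (simp add: mult_ac)
  also have "\<dots> \<le> ((1 - p) ^ t * ideal_prob t K (insert j Z) (h @ [(q, Invalid)])) *
      real (card (extensions M N K (insert j Z)))"
    using card_le p by (intro mult_left_mono) auto
  also have "\<dots> \<le> (\<Sum>S\<in>extensions M N K (insert j Z). graph_prob S t (h @ [(q, Invalid)]))"
    using IH[OF valid] by (simp add: dominates_def mult_ac)
  also have "\<dots> = (\<Sum>S\<in>extensions M N K (insert j Z). measure_pmf.prob (bind_pmf (answer_pmf (hard_graph k S) q)
      (\<lambda>y. run A (hard_graph k S) t (h @ [(q, y)]))) R)"
  proof (rule sum.cong[OF refl])
    fix S assume "S \<in> extensions M N K (insert j Z)"
    then have "\<not> known k S x"
      unfolding j by (auto simp: extensions_def)
    then show "graph_prob S t (h @ [(q, Invalid)]) = measure_pmf.prob (bind_pmf (answer_pmf (hard_graph k S) q)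
      (\<lambda>y. run A (hard_graph k S) t (h @ [(q, y)]))) R"
      by (simp add: q bind_return_pmf)
  qed
  also have "\<dots> \<le> (\<Sum>S\<in>extensions M N K Z. measure_pmf.prob (bind_pmf (answer_pmf (hard_graph k S) q)
      (\<lambda>y. run A (hard_graph k S) t (h @ [(q, y)]))) R)"
    by (intro sum_mono2 finite_extensions) (auto simp: extensions_def)
  finally show ?thesis
    by (simp add: j_def)
qed

text \<open>Only clique edges are kept among the real answers. Each has probability 1 /
  \<open>m\<close> instead of 1 / (\<open>k choose 2\<close>), a loss of at most
  \<open>1 - p\<close> by \<open>p_edge\<close>.\<close>

lemma step_RandEdge:
  "(1 - p) ^ Suc t * real (card (extensions M N K Z)) *
      measure_pmf.prob (bind_pmf (ideal_answer k M K Z RandEdge)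
        (\<lambda>(y, K', Z'). ideal_run A k M t K' Z' (h @ [(RandEdge, y)]))) R \<le>
    (\<Sum>S\<in>extensions M N K Z. measure_pmf.prob (bind_pmf (answer_pmf (hard_graph k S) RandEdge)
      (\<lambda>y. run A (hard_graph k S) t (h @ [(RandEdge, y)]))) R)"
proof -
  let ?C = "clique_edges k"
  let ?c = "real (card (extensions M N K Z))"
  let ?h = "\<lambda>e. h @ [(RandEdge, Edge e)]"
  have C: "?C \<noteq> {}"
  proof -
    have "0 < card ?C" using k by (simp add: card_clique_edges)
    then show ?thesis by auto
  qed
  define m where "m = real ((k choose 2) + N)"
  have m: "0 < m" using T by (simp add: m_def)
  have edge: "(\<Sum>e\<in>?C. graph_prob S t (?h e)) / m \<le>
      measure_pmf.prob (bind_pmf (answer_pmf (hard_graph k S) RandEdge)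
        (\<lambda>y. run A (hard_graph k S) t (h @ [(RandEdge, y)]))) R"
    if S: "S \<in> extensions M N K Z" for S
  proof -
    have finS: "finite S" using S by (rule finite_extension)
    have fin: "finite (edges (hard_graph k S))" "edges (hard_graph k S) \<noteq> {}"
      using C finS by (auto simp: hard_graph_def finite_clique_edges)
    have "card S = N" using S by (simp add: extensions_def)
    then have m_eq: "m = real (card (edges (hard_graph k S)))"
      using num_edges_hard_graph[OF finS, of k] by (simp add: m_def num_edges_def)
    have "(\<Sum>e\<in>?C. graph_prob S t (?h e)) \<le> (\<Sum>e\<in>edges (hard_graph k S). graph_prob S t (?h e))"
      using fin by (intro sum_mono2) (auto simp: hard_graph_def)
    then show ?thesis
      using fin m by (simp add: bind_map_pmf measure_bind_pmf integral_pmf_of_set m_eq[symmetric] divide_right_mono)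
  qed
  have "(1 - p) ^ Suc t * ?c *
      measure_pmf.prob (bind_pmf (ideal_answer k M K Z RandEdge)
        (\<lambda>(y, K', Z'). ideal_run A k M t K' Z' (h @ [(RandEdge, y)]))) R =
      (1 - p) / real (k choose 2) * (\<Sum>e\<in>?C. (1 - p) ^ t * ?c * ideal_prob t K Z (?h e))"
    using C by (simp add: bind_map_pmf measure_bind_pmf integral_pmf_of_set finite_clique_edges
        card_clique_edges sum_distrib_left[symmetric])
  also have "\<dots> \<le> (1 - p) / real (k choose 2) * (\<Sum>e\<in>?C. \<Sum>S\<in>extensions M N K Z. graph_prob S t (?h e))"
    using p IH[OF valid_state_Suc] by (intro mult_left_mono sum_mono) (auto simp: dominates_def)
  also have "\<dots> \<le> 1 / m * (\<Sum>e\<in>?C. \<Sum>S\<in>extensions M N K Z. graph_prob S t (?h e))"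
  proof (rule mult_right_mono)
    have "0 < real (k choose 2)" using k by simp
    then show "(1 - p) / real (k choose 2) \<le> 1 / m"
      using p_edge m unfolding m_def[symmetric] by (simp add: field_simps)
  qed (simp add: sum_nonneg)
  also have "\<dots> = (\<Sum>S\<in>extensions M N K Z. (\<Sum>e\<in>?C. graph_prob S t (?h e)) / m)"
    by (subst sum.swap) (simp add: sum_divide_distrib)
  also have "\<dots> \<le> (\<Sum>S\<in>extensions M N K Z. measure_pmf.prob (bind_pmf (answer_pmf (hard_graph k S) RandEdge)
        (\<lambda>y. run A (hard_graph k S) t (h @ [(RandEdge, y)]))) R)"
    using edge by (rule sum_mono)
  finally show ?thesis .
qed

text \<open>Only vertices of unrevealed pairs are kept. Swapping the sums over extensions and over
  pairs yields, for each revealed \<open>j\<close>, a sum over the extensions of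
  \<open>insert j K\<close>, to which the induction hypothesis applies.\<close>

lemma step_RandVert:
  "(1 - p) ^ Suc t * real (card (extensions M N K Z)) *
      measure_pmf.prob (bind_pmf (ideal_answer k M K Z RandVert)
        (\<lambda>(y, K', Z'). ideal_run A k M t K' Z' (h @ [(RandVert, y)]))) R \<le>
    (\<Sum>S\<in>extensions M N K Z. measure_pmf.prob (bind_pmf (answer_pmf (hard_graph k S) RandVert)
      (\<lambda>y. run A (hard_graph k S) t (h @ [(RandVert, y)]))) R)"
proof -
  define W where "W = {..<M} - Z - K"
  define n where "n = real (k + 2 * N)"
  define c where "c = real (card (extensions M N K Z))"
  let ?h = "\<lambda>j b. h @ [(RandVert, Vertex (pair_vertex k (j, b)))]"
  have n: "0 < n" using k by (simp add: n_def)
  have KZ: "K \<subseteq> {..<M} - Z"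
    using state by (auto simp: valid_state_def)
  have "0 < card W"
    using valid_state_facts(4)[OF state] by (simp add: W_def)
  then have W: "finite W" "0 < card W" "W \<noteq> {}"
    by (simp_all add: card_gt_0_iff)
  have vertex: "(\<Sum>j\<in>S - K. \<Sum>b\<in>{0, 1}. graph_prob S t (?h j b)) / n \<le>
      measure_pmf.prob (bind_pmf (answer_pmf (hard_graph k S) RandVert)
        (\<lambda>y. run A (hard_graph k S) t (h @ [(RandVert, y)]))) R"
    if S: "S \<in> extensions M N K Z" for S
  proof -
    have finS: "finite S" using S by (rule finite_extension)
    have fin: "finite (verts (hard_graph k S))" "verts (hard_graph k S) \<noteq> {}"
      using finS k by (auto simp: hard_graph_def lessThan_empty_iff)
    have "card S = N" using S by (simp add: extensions_def)
    then have n_eq: "n = real (card (verts (hard_graph k S)))"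
      using num_verts_hard_graph[OF finS, of k] by (simp add: n_def num_verts_def)
    let ?g = "\<lambda>x. graph_prob S t (h @ [(RandVert, Vertex x)])"
    have "(\<Sum>j\<in>S - K. \<Sum>b\<in>{0, 1}. graph_prob S t (?h j b)) = (\<Sum>v\<in>(S - K) \<times> {0, 1}. ?g (pair_vertex k v))"
      by (simp only: sum.cartesian_product) (simp add: case_prod_unfold)
    also have "\<dots> = (\<Sum>x\<in>pair_vertex k ` ((S - K) \<times> {0, 1}). ?g x)"
      by (rule sum.reindex_cong[OF inj_on_subset[OF inj_on_pair_vertex[of k S]] refl refl, symmetric]) auto
    also have "\<dots> \<le> (\<Sum>x\<in>verts (hard_graph k S). ?g x)"
      using fin by (intro sum_mono2) (auto simp: hard_graph_def)
    finally show ?thesis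
      using fin n by (simp add: bind_map_pmf measure_bind_pmf integral_pmf_of_set n_eq[symmetric] divide_right_mono)
  qed
  have IH': "(1 - p) ^ t * ((N - card K) * c / card W) * ideal_prob t (insert j K) Z (?h j b) \<le>
      (\<Sum>S\<in>extensions M N (insert j K) Z. graph_prob S t (?h j b))" if j: "j \<in> W" for j b
  proof -
    have valid: "valid_state t (insert j K) Z"
      using j state valid_state_facts(1)[OF state] by (auto simp: valid_state_def W_def card_insert_if)
    have card: "real (card (extensions M N (insert j K) Z)) = (N - card K) * c / card W"
      using card_extensions_insert_revealed[OF KZ K_less j[unfolded W_def]] W(2)
      by (simp add: W_def[symmetric] c_def field_simps flip: of_nat_mult)
    show ?thesis
      using IH[OF valid, of "?h j b"] unfolding dominates_def card .
  qed
  have "(1 - p) ^ Suc t * c *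
      measure_pmf.prob (bind_pmf (ideal_answer k M K Z RandVert)
        (\<lambda>(y, K', Z'). ideal_run A k M t K' Z' (h @ [(RandVert, y)]))) R =
      (1 - p) * ((1 - p) ^ t * c * (\<Sum>j\<in>W. \<Sum>b\<in>{0, 1}. ideal_prob t (insert j K) Z (?h j b)) / (2 * card W))"
  proof -
    have "(\<Sum>v\<in>W \<times> {0, 1}. ideal_prob t (insert (fst v) K) Z (h @ [(RandVert, Vertex (pair_vertex k v))])) =
        (\<Sum>j\<in>W. \<Sum>b\<in>{0, 1}. ideal_prob t (insert j K) Z (?h j b))"
      by (simp only: sum.cartesian_product) (simp add: case_prod_unfold)
    then show ?thesis
      using W by (simp add: W_def[symmetric] bind_map_pmf measure_bind_pmf integral_pmf_of_set
          card_cartesian_product del: sum.insert sum.empty)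
  qed
  \<comment> \<open>The new factor is the true probability that a random vertex lies in an
    unrevealed pair.\<close>
  also have "\<dots> \<le> (2 * real (N - card K) / n) *
      ((1 - p) ^ t * c * (\<Sum>j\<in>W. \<Sum>b\<in>{0, 1}. ideal_prob t (insert j K) Z (?h j b)) / (2 * card W))"
  proof (rule mult_right_mono)
    have "2 * real (N - T) / n \<le> 2 * real (N - card K) / n"
      using n valid_state_facts(2)[OF state] by (intro divide_right_mono) auto
    then show "1 - p \<le> 2 * real (N - card K) / n"
      using p_vertex unfolding n_def by linarith
  qed (use p in \<open>simp add: sum_nonneg c_def\<close>)
  also have "\<dots> = (\<Sum>j\<in>W. \<Sum>b\<in>{0, 1}. (1 - p) ^ t * ((N - card K) * c / card W) * ideal_prob t (insert j K) Z (?h j b)) / n"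
    by (simp only: sum_distrib_left[symmetric]) (simp add: field_simps)
  also have "\<dots> \<le> (\<Sum>j\<in>W. \<Sum>b\<in>{0, 1}. \<Sum>S\<in>extensions M N (insert j K) Z. graph_prob S t (?h j b)) / n"
    using IH' n by (intro divide_right_mono sum_mono) auto
  also have "\<dots> = (\<Sum>j\<in>W. \<Sum>S\<in>extensions M N (insert j K) Z. \<Sum>b\<in>{0, 1}. graph_prob S t (?h j b)) / n"
    by (subst sum.swap) (rule refl)
  also have "\<dots> = (\<Sum>S\<in>extensions M N K Z. (\<Sum>j\<in>S - K. \<Sum>b\<in>{0, 1}. graph_prob S t (?h j b)) / n)"
    unfolding W_def using sum_extensions_swap[OF KZ, where N = N and g = "\<lambda>S j. \<Sum>b\<in>{0, 1}. graph_prob S t (?h j b)"]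
    by (simp only: sum_divide_distrib[symmetric])
  also have "\<dots> \<le> (\<Sum>S\<in>extensions M N K Z. measure_pmf.prob (bind_pmf (answer_pmf (hard_graph k S) RandVert)
        (\<lambda>y. run A (hard_graph k S) t (h @ [(RandVert, y)]))) R)"
    using vertex by (rule sum_mono)
  finally show ?thesis
    by (simp add: c_def)
qed

lemma step_vertex:
  assumes q: "q = RandNbr x \<or> q = Degree x \<or> q = FullNbrHood x"
  shows "(1 - p) ^ Suc t * real (card (extensions M N K Z)) *
      measure_pmf.prob (bind_pmf (ideal_answer k M K Z q)
        (\<lambda>(y, K', Z'). ideal_run A k M t K' Z' (h @ [(q, y)]))) R \<le>
    (\<Sum>S\<in>extensions M N K Z. measure_pmf.prob (bind_pmf (answer_pmf (hard_graph k S) q)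
      (\<lambda>y. run A (hard_graph k S) t (h @ [(q, y)]))) R)"
proof -
  have ideal: "ideal_answer k M K Z q = ideal_vertex_answer k K Z q x"
    using q by auto
  show ?thesis
  proof (cases "known k K x")
    case True
    have "answer_pmf (hard_graph k S) q = answer_pmf (hard_graph k K) q" if "S \<in> extensions M N K Z" for S
    proof -
      have "K \<subseteq> S" using that by (simp add: extensions_def)
      moreover from this have "known k S x" using True by (auto simp: known_def)
      ultimately show ?thesis
        using q True by (auto simp: deg_def nbrs_hard_graph_mono known_iff)
    qed
    then show ?thesis
      using True step_known_answers[of q] by (simp add: ideal ideal_vertex_answer_def bind_map_pmf)
  next
    case False
    have "answer_pmf (hard_graph k S) q = return_pmf Invalid" if "\<not> known k S x" for S
      using q that by (auto simp: known_iff)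
    then show ?thesis
      using step_guess[OF False] False by (simp add: ideal ideal_vertex_answer_def bind_return_pmf)
  qed
qed

lemma dominates_Suc: "dominates (Suc t) K Z h"
  unfolding dominates_def run.simps ideal_run.simps
proof (rule expectation_mono_scaled)
  fix a
  show "(1 - p) ^ Suc t * real (card (extensions M N K Z)) *
      measure_pmf.prob (case a of Ask q \<Rightarrow> bind_pmf (ideal_answer k M K Z q)
        (\<lambda>(y, K', Z'). ideal_run A k M t K' Z' (h @ [(q, y)])) | Return r \<Rightarrow> return_pmf (Some r)) R \<le>
    (\<Sum>S\<in>extensions M N K Z. measure_pmf.prob (case a of Ask q \<Rightarrow> bind_pmf (answer_pmf (hard_graph k S) q)
      (\<lambda>y. run A (hard_graph k S) t (h @ [(q, y)])) | Return r \<Rightarrow> return_pmf (Some r)) R)"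
  proof (cases a)
    case (Return r)
    have "(1 - p) ^ Suc t \<le> 1"
      using p by (intro power_le_one) auto
    then show ?thesis
      using Return mult_right_mono[of "(1 - p) ^ Suc t" 1 "real (card (extensions M N K Z)) * indicator R (Some r)"]
      by (simp add: mult_ac)
  next
    case (Ask q)
    have "(1 - p) ^ Suc t * real (card (extensions M N K Z)) *
        measure_pmf.prob (bind_pmf (ideal_answer k M K Z q)
          (\<lambda>(y, K', Z'). ideal_run A k M t K' Z' (h @ [(q, y)]))) R \<le>
      (\<Sum>S\<in>extensions M N K Z. measure_pmf.prob (bind_pmf (answer_pmf (hard_graph k S) q)
        (\<lambda>y. run A (hard_graph k S) t (h @ [(q, y)]))) R)"
      using step_RandVert step_RandEdge step_vertex by (cases q) blast+
    then show ?thesis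
      using Ask by simp
  qed
qed

end

lemma dominates: "valid_state t K Z \<Longrightarrow> dominates t K Z h"
proof (induction t arbitrary: K Z h)
  case 0
  show ?case
    by (simp add: dominates_def)
next
  case (Suc t)
  then show ?case by (intro dominates_Suc)
qed

lemma ideal_prob_le_average:
  "(1 - p) ^ T * real (card (extensions M N {} {})) * ideal_prob T {} {} [] \<le>
    (\<Sum>S\<in>extensions M N {} {}. graph_prob S T [])"
  using dominates[of T "{}" "{}" "[]"] by (simp add: valid_state_def dominates_def)

end

section \<open>The lower bound\<close>

text \<open>A returned value is final; raising the cutoff can only turn \<open>None\<close> into a
  result.\<close>

lemma prob_run_mono:
  assumes "s \<le> t"
  shows "measure_pmf.prob (run A G s h) (Some ` S) \<le> measure_pmf.prob (run A G t h) (Some ` S)"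
proof -
  have "measure_pmf.prob (run A G t h) (Some ` S) \<le> measure_pmf.prob (run A G (Suc t) h) (Some ` S)" for t
  proof (induction t arbitrary: h)
    case 0
    show ?case
      by (simp add: measure_bind_pmf, intro integral_mono integrable_prob) (auto split: action.splits)
  next
    case (Suc t)
    have "measure_pmf.prob (case a of Ask q \<Rightarrow> answer_pmf G q \<bind> (\<lambda>y. run A G t (h @ [(q, y)]))
          | Return r \<Rightarrow> return_pmf (Some r)) (Some ` S) \<le>
        measure_pmf.prob (case a of Ask q \<Rightarrow> answer_pmf G q \<bind> (\<lambda>y. run A G (Suc t) (h @ [(q, y)]))
          | Return r \<Rightarrow> return_pmf (Some r)) (Some ` S)" for a
      unfolding measure_bind_pmf using Suc
      by (cases a) (auto simp del: run.simps simp: measure_bind_pmf intro!: integral_mono integrable_prob)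
    then show ?case
      unfolding run.simps(2)[of A G "Suc t"] run.simps(2)[of A G t] measure_bind_pmf
      by (intro integral_mono integrable_prob)
  qed
  then show ?thesis
    using assms by (rule lift_Suc_mono_le)
qed

lemma prob_within_limit:
  assumes "outputs_in A G S" and "\<And>t. prob_within A G S t \<le> b"
  shows "99 / 100 \<le> b"
  using assms cSUP_least[of UNIV "prob_within A G S" b] unfolding outputs_in_def by force

text \<open>Failure at the cutoff is either a wrong value, which persists at all later cutoffs, or
  no value yet. Each has probability at most 1/100.\<close>

lemma prob_at_cutoff:
  assumes "outputs_in A G S" "99 / 100 \<le> prob_within A G UNIV T"
  shows "measure_pmf.prob (run A G T []) (- Some ` S) \<le> 2 / 100"
proof -
  let ?P = "\<lambda>t X. measure_pmf.prob (run A G t []) X"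
  have "prob_within A G S t \<le> 1 - ?P T (Some ` (- S))" for t
  proof -
    \<comment> \<open>The two cutoffs are compared at their maximum, where right and wrong outputs
      exclude each other.\<close>
    have "prob_within A G S t \<le> ?P (max t T) (Some ` S)"
      unfolding prob_within_def by (rule prob_run_mono) simp
    also have "\<dots> \<le> ?P (max t T) (- Some ` (- S))"
      by (intro measure_pmf.finite_measure_mono) auto
    also have "\<dots> = 1 - ?P (max t T) (Some ` (- S))"
      using measure_pmf.prob_compl[of "Some ` (- S)" "run A G (max t T) []"] by (simp add: Compl_eq_Diff_UNIV)
    also have "\<dots> \<le> 1 - ?P T (Some ` (- S))"
      using prob_run_mono[of T "max t T" A G "[]" "- S"] by simp
    finally show ?thesis .
  qed
  then have "99 / 100 \<le> 1 - ?P T (Some ` (- S))"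
    by (rule prob_within_limit[OF assms(1)])
  moreover have "?P T (- Some ` UNIV) = 1 - ?P T (Some ` UNIV)"
    using measure_pmf.prob_compl[of "Some ` UNIV" "run A G T []"] by (simp add: Compl_eq_Diff_UNIV)
  moreover have "?P T (- Some ` S) \<le> ?P T (Some ` (- S) \<union> - Some ` UNIV)"
    by (intro measure_pmf.finite_measure_mono) auto
  moreover have "\<dots> \<le> ?P T (Some ` (- S)) + ?P T (- Some ` UNIV)"
    by (intro measure_Un_le) auto
  ultimately show ?thesis
    using assms(2) unfolding prob_within_def by linarith
qed

text \<open>A value in \<open>S'\<close> returned by the cutoff is a final wrong answer, however
  long the algorithm may run otherwise.\<close>

lemma prob_disjoint_output:
  assumes "outputs_in A G S" "S \<inter> S' = {}"
  shows "measure_pmf.prob (run A G T []) (Some ` S') \<le> 1 / 100"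
proof -
  let ?P = "\<lambda>t X. measure_pmf.prob (run A G t []) X"
  have "prob_within A G S t \<le> 1 - ?P T (Some ` S')" for t
  proof -
    have "prob_within A G S t \<le> ?P (max t T) (Some ` S)"
      unfolding prob_within_def by (rule prob_run_mono) simp
    also have "\<dots> \<le> ?P (max t T) (- Some ` S')"
      using assms(2) by (intro measure_pmf.finite_measure_mono) auto
    also have "\<dots> = 1 - ?P (max t T) (Some ` S')"
      using measure_pmf.prob_compl[of "Some ` S'" "run A G (max t T) []"] by (simp add: Compl_eq_Diff_UNIV)
    also have "\<dots> \<le> 1 - ?P T (Some ` S')"
      using prob_run_mono[of T "max t T" A G "[]" S'] by simp
    finally show ?thesis .
  qed
  then have "99 / 100 \<le> 1 - ?P T (Some ` S')"
    by (rule prob_within_limit[OF assms(1)])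
  then show ?thesis by simp
qed

text \<open>Any event is at most twice as likely in the ideal process as its uniform bound on the
  hard graphs. With \<open>N1\<close> pairs the ideal output misses \<open>S1\<close> with
  probability at most 4/100, with \<open>N2\<close> pairs it hits \<open>S1\<close> with at most
  2/100, and these cannot add up to 1. The query bound enters through the graphs with
  \<open>N1\<close> pairs alone.\<close>

lemma confusion:
  assumes k: "2 \<le> k" and p: "0 \<le> p" "p \<le> 1" "1 / 2 \<le> (1 - p) ^ T"
    and N: "\<And>N. N \<in> {N1, N2} \<Longrightarrow> T < N \<and> N + T \<le> M \<and>
      1 - p \<le> 2 * real (N - T) / real (k + 2 * N) \<and>
      1 - p \<le> real (k choose 2) / real ((k choose 2) + N) \<and> real N \<le> p * real (M - T)"
    and fast: "\<And>S. S \<in> extensions M N1 {} {} \<Longrightarrow> 99 / 100 \<le> prob_within A (hard_graph k S) UNIV T"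
    and out1: "\<And>S. S \<in> extensions M N1 {} {} \<Longrightarrow> outputs_in A (hard_graph k S) S1"
    and out2: "\<And>S. S \<in> extensions M N2 {} {} \<Longrightarrow> outputs_in A (hard_graph k S) S2"
    and disjoint: "S2 \<inter> S1 = {}"
  shows False
proof -
  let ?I = "measure_pmf.prob (ideal_run A k M T {} {} [])"
  have bound: "?I R \<le> 2 * b"
    if N': "N' \<in> {N1, N2}"
      and b: "\<And>S. S \<in> extensions M N' {} {} \<Longrightarrow> measure_pmf.prob (run A (hard_graph k S) T []) R \<le> b" for N' R b
  proof -
    let ?c = "real (card (extensions M N' {} {}))"
    have "0 < ?c"
      using N[OF N'] by (simp add: card_extensions)
    have "1 / 2 * (?c * ?I R) \<le> (1 - p) ^ T * (?c * ?I R)"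
      using p(3) by (intro mult_right_mono) auto
    also have "\<dots> = (1 - p) ^ T * ?c * ?I R"
      by simp
    also have "\<dots> \<le> (\<Sum>S\<in>extensions M N' {} {}. measure_pmf.prob (run A (hard_graph k S) T []) R)"
      using N[OF N'] by (intro ideal_prob_le_average[OF k _ _ p(1,2)]) auto
    also have "\<dots> \<le> ?c * b"
      by (rule sum_bounded_above) (rule b)
    finally have "?c * ?I R \<le> ?c * (2 * b)"
      by simp
    then show ?thesis
      using \<open>0 < ?c\<close> by (rule mult_left_le_imp_le)
  qed
  have "?I (- Some ` S1) \<le> 2 * (2 / 100)"
    by (rule bound[of N1]) (simp, rule prob_at_cutoff[OF out1 fast])
  moreover have "?I (Some ` S1) \<le> 2 * (1 / 100)"
    by (rule bound[of N2]) (simp, rule prob_disjoint_output[OF out2 disjoint])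
  moreover have "?I (- Some ` S1) = 1 - ?I (Some ` S1)"
    using measure_pmf.prob_compl[of "Some ` S1" "ideal_run A k M T {} {} []"] by (simp add: Compl_eq_Diff_UNIV)
  ultimately show False by simp
qed

section \<open>Average degrees and parameters of the hard graphs\<close>

lemma real_choose_2: "2 * real (k choose 2) = real k * (real k - 1)"
  by (induction k) (auto simp: numeral_2_eq_2 algebra_simps)

lemma avg_deg_hard_graph:
  "finite S \<Longrightarrow> avg_deg (hard_graph k S) =
    (real k * (real k - 1) + 2 * real (card S)) / (real k + 2 * real (card S))"
  by (simp add: avg_deg_def num_edges_hard_graph num_verts_hard_graph distrib_left real_choose_2)

text \<open>The graphs with \<open>N1\<close> pairs have exactly \<open>n\<close> vertices. Those
  with \<open>N2\<close> pairs have an average degree smaller by more than the factor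
  \<open>c\<close>^2, so no value suits both.\<close>

lemma query_lower_bound:
  fixes c :: real
  assumes c: "c \<ge> 1"
  obtains \<kappa> :: real and n\<^sub>0 :: nat where "\<kappa> > 0"
    and "\<And>A n. (\<And>G. input_graph G \<Longrightarrow> outputs_in A G (factor_approx c G)) \<Longrightarrow> n\<^sub>0 \<le> n \<Longrightarrow>
      \<exists>G. input_graph G \<and> num_verts G = n \<and>
        (\<forall>q. q < \<kappa> * real n powr (1 / 3) \<longrightarrow> \<not> outputs_in_using A G UNIV q)"
proof -
  \<comment> \<open>This choice cuts the clique's share of the average degree by a factor of at
    least 4 * \<open>c\<close>^2.\<close>
  define B where "B = nat \<lceil>2 * c\<^sup>2\<rceil>"
  have "1 \<le> c\<^sup>2" using c by simp
  have B: "2 * c\<^sup>2 \<le> real B" "1 \<le> real B"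
  proof -
    show *: "2 * c\<^sup>2 \<le> real B" unfolding B_def by linarith
    show "1 \<le> real B" using * \<open>1 \<le> c\<^sup>2\<close> by linarith
  qed
  \<comment> \<open>The first term keeps \<open>p\<close> at most 1/2. The second serves the gap
    between the average degrees and the comparisons of powers of \<open>x\<close>.\<close>
  define X where "X = max (8 * real B) (4 * c\<^sup>2 + 10)"
  have "\<exists>G. input_graph G \<and> num_verts G = n \<and>
        (\<forall>q. q < 1 / (8 * real B) * real n powr (1 / 3) \<longrightarrow> \<not> outputs_in_using A G UNIV q)"
    if correct: "\<And>G. input_graph G \<Longrightarrow> outputs_in A G (factor_approx c G)"
      and n: "nat \<lceil>X ^ 3\<rceil> \<le> n" for A n
  proof (rule ccontr)
    assume contra: "\<not> ?thesis"
    define x where "x = real n powr (1 / 3)"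
    have "0 \<le> X" using \<open>1 \<le> c\<^sup>2\<close> by (simp add: X_def)
    have "X ^ 3 \<le> real n"
      using n by linarith
    then have "(X ^ 3) powr (1 / 3) \<le> x"
      unfolding x_def using \<open>0 \<le> X\<close> by (intro powr_mono2) auto
    moreover have "(X ^ 3) powr (1 / 3) = X"
      using \<open>0 \<le> X\<close> by (simp add: powr_powr flip: powr_numeral)
    ultimately have x: "8 * real B \<le> x" "4 * c\<^sup>2 + 10 \<le> x" "10 \<le> x"
      using \<open>1 \<le> c\<^sup>2\<close> by (auto simp: X_def)
    have "0 < real n"
      using x(3) by (cases "n = 0") (auto simp: x_def)
    then have n_eq: "real n = x ^ 3"
      by (simp add: x_def powr_powr flip: powr_numeral)
    define k0 where "k0 = nat \<lceil>x\<^sup>2\<rceil>"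
    \<comment> \<open>The parity correction makes \<open>n - k\<close> even, so the remaining
      vertices can be matched perfectly.\<close>
    define k where "k = k0 + (n - k0) mod 2"
    have x2: "10 * x \<le> x\<^sup>2" "10 * x\<^sup>2 \<le> x ^ 3"
      using x(3) by (simp_all add: power2_eq_square power3_eq_cube mult_right_mono)
    have k: "x\<^sup>2 \<le> real k" "real k \<le> x\<^sup>2 + 2"
    proof -
      show "x\<^sup>2 \<le> real k" unfolding k_def k0_def by linarith
      have "real k0 \<le> x\<^sup>2 + 1" unfolding k0_def using zero_le_power2[of x] by linarith
      moreover have "real ((n - k0) mod 2) \<le> 1" by simp
      ultimately show "real k \<le> x\<^sup>2 + 2" unfolding k_def by simp
    qed
    have "k0 \<le> n"
      using k x2 x(3) n_eq unfolding k_def by simp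
    define N1 where "N1 = (n - k) div 2"
    define N2 where "N2 = B * n"
    have "real k \<le> real n"
      using k(2) x2 x(3) n_eq by linarith
    then have "k \<le> n" by simp
    have n_split: "n = k + 2 * N1"
    proof -
      define r where "r = n - k0"
      have n: "n = k0 + r" and k: "k = k0 + r mod 2"
        using \<open>k0 \<le> n\<close> by (simp_all add: r_def k_def)
      have "n - k = 2 * (r div 2)"
        unfolding n k by (simp add: minus_mod_eq_mult_div)
      then show ?thesis
        using \<open>k \<le> n\<close> by (simp add: N1_def)
    qed
    \<comment> \<open>\<open>T * p\<close> is at most 1/2, so Bernoulli's inequality gives
      \<open>(1 - p) ^ T\<close> at least 1/2. With \<open>M - T = n * N2\<close> a guess hits with
      probability at most 1 / \<open>n\<close>.\<close>
    define T where "T = nat \<lfloor>1 / (8 * real B) * x\<rfloor>"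
    define p where "p = 4 * real B / x"
    define M where "M = T + n * N2"
    have T: "real T \<le> 1 / (8 * real B) * x"
      unfolding T_def using x(3) by (intro of_nat_floor) simp
    also have "\<dots> \<le> 1 * x"
      using B x(3) by (intro mult_right_mono) auto
    finally have Tx: "real T \<le> x" by simp
    have p: "0 \<le> p" "p \<le> 1"
      using x B by (simp_all add: p_def)
    have "real T * p \<le> 1 / 2"
    proof -
      have "real T * p \<le> (1 / (8 * real B) * x) * p"
        using T p by (intro mult_right_mono) auto
      also have "\<dots> = 1 / 2"
        using B x(3) by (simp add: p_def)
      finally show ?thesis .
    qed
    then have pT: "1 / 2 \<le> (1 - p) ^ T"
      using Bernoulli_inequality[of "- p" T] p by simp
    have k_sq: "x ^ 4 \<le> 2 * (real k * (real k - 1))"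
    proof -
      have "x\<^sup>2 * x\<^sup>2 \<le> real k * (2 * (real k - 1))"
        using k x2 x(3) by (intro mult_mono) auto
      then show ?thesis
        by (simp add: power4_eq_xxxx power2_eq_square algebra_simps)
    qed
    have sizes: "real N1 \<le> real N2" "real T < real N1" "real n \<le> real (k + 2 * N1)" "real n \<le> real (k + 2 * N2)"
    proof -
      have "real n \<le> real N2"
        using mult_right_mono[OF B(2), of "real n"] by (simp add: N2_def)
      moreover have "real n = real k + 2 * real N1"
        using n_split by simp
      ultimately show "real N1 \<le> real N2" "real n \<le> real (k + 2 * N1)" "real n \<le> real (k + 2 * N2)"
        by simp_all
      show "real T < real N1"
        using \<open>real n = real k + 2 * real N1\<close> k(2) x2 x(3) n_eq Tx by linarith
    qed
    have px: "p * x ^ 3 = 4 * real B * x\<^sup>2" "p * x ^ 4 = 4 * real B * x ^ 3"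
      using x(3) by (simp_all add: p_def power2_eq_square power3_eq_cube power4_eq_xxxx)
    have conditions: "T < N \<and> N + T \<le> M \<and>
      1 - p \<le> 2 * real (N - T) / real (k + 2 * N) \<and>
      1 - p \<le> real (k choose 2) / real ((k choose 2) + N) \<and> real N \<le> p * real (M - T)"
      if "N \<in> {N1, N2}" for N
    proof -
      have N: "real T < real N" "real N \<le> real N2" "real n \<le> real (k + 2 * N)"
        using that sizes by auto
      have "0 < n" using \<open>0 < real n\<close> by simp
      have "N \<le> N2" using N by simp
      then have "N + T \<le> M"
        using \<open>0 < n\<close> by (cases n) (auto simp: M_def)
      \<comment> \<open>The vertex condition without denominators: the clique and \<open>T\<close>
        revealed pairs make up at most a fraction \<open>p\<close> of the vertices.\<close>
      have "real k + 2 * real T \<le> p * x ^ 3"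
      proof -
        have "4 * 1 * x\<^sup>2 \<le> 4 * real B * x\<^sup>2"
          using B(2) by (intro mult_mono) auto
        then show ?thesis
          using px(1) k(2) Tx x2 x(3) by linarith
      qed
      also have "\<dots> \<le> p * real (k + 2 * N)"
        using N(3) p(1) n_eq by (intro mult_left_mono) auto
      finally have "(1 - p) * real (k + 2 * N) \<le> 2 * real (N - T)"
        using N(1) by (simp add: algebra_simps of_nat_diff)
      moreover have "0 < real (k + 2 * N)" using N(1) by simp
      ultimately have vertex: "1 - p \<le> 2 * real (N - T) / real (k + 2 * N)"
        by (simp only: pos_le_divide_eq)
      \<comment> \<open>This fixes the size of \<open>p\<close>: the clique has at least x^4 / 4
        edges, and p * x^4 / 4 = B * x^3.\<close>
      have "real N \<le> real B * x ^ 3"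
        using N(2) n_eq by (simp add: N2_def)
      also have "4 * (real B * x ^ 3) = p * x ^ 4"
        using px(2) by simp
      then have "real B * x ^ 3 = p * (x ^ 4 / 4)" by simp
      also have "\<dots> \<le> p * real (k choose 2)"
        using k_sq real_choose_2[of k] p(1) by (intro mult_left_mono) auto
      finally have "real N \<le> p * real (k choose 2)" .
      moreover have "0 \<le> p * real N"
        using p(1) by simp
      moreover have "(1 - p) * real ((k choose 2) + N) =
          real (k choose 2) + real N - (p * real (k choose 2) + p * real N)"
        by (simp add: algebra_simps)
      ultimately have "(1 - p) * real ((k choose 2) + N) \<le> real (k choose 2)"
        by linarith
      moreover have "0 < real ((k choose 2) + N)" using N(1) by simp
      ultimately have edge: "1 - p \<le> real (k choose 2) / real ((k choose 2) + N)"
        by (simp only: pos_le_divide_eq)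
      have "1 * real N2 \<le> (p * real n) * real N2"
      proof (rule mult_right_mono)
        have "1 \<le> 4 * real B * x\<^sup>2"
          using B(2) x2 x(3) mult_mono[of 1 "4 * real B" 1 "x\<^sup>2"] by simp
        then show "1 \<le> p * real n"
          using px(1) n_eq by simp
      qed simp
      then have "real N \<le> p * real (M - T)"
        using N(2) by (simp add: M_def mult.assoc)
      then show ?thesis
        using N(1) \<open>N + T \<le> M\<close> vertex edge by simp
    qed
    have k2: "2 \<le> k"
    proof -
      have "2 \<le> real k" using k(1) x2 x(3) by linarith
      then show ?thesis by simp
    qed
    define d where "d N = (real k * (real k - 1) + 2 * real N) / (real k + 2 * real N)" for N
    have ext: "finite S" "card S = N" "input_graph (hard_graph k S)" "num_verts (hard_graph k S) = k + 2 * N"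
        "outputs_in A (hard_graph k S) {d N / c..c * d N}"
      if "S \<in> extensions M N {} {}" for S N
    proof -
      show fin: "finite S" and N: "card S = N"
        using that finite_subset[of S "{..<M}"] by (auto simp: extensions_def)
      show G: "input_graph (hard_graph k S)"
        using fin k2 by (rule input_graph_hard_graph)
      show "num_verts (hard_graph k S) = k + 2 * N"
        using fin N by (simp add: num_verts_hard_graph)
      show "outputs_in A (hard_graph k S) {d N / c..c * d N}"
        using correct[OF G] fin N by (simp add: factor_approx_def avg_deg_hard_graph d_def)
    qed
    \<comment> \<open>With K = k * (k - 1), the larger graph gives c^2 * d N2 at most K / (4 * n) +
      c^2, and c^2 is below 3/4 of K / n because K / n is at least x / 2.\<close>
    have separated: "c * d N2 < d N1 / c"
    proof -
      let ?K = "real k * (real k - 1)"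
      have "0 \<le> ?K" using k2 by simp
      have "d N2 \<le> ?K / (2 * real N2) + 1"
      proof -
        have "d N2 \<le> (?K + 2 * real N2) / (2 * real N2)"
          unfolding d_def using \<open>0 \<le> ?K\<close> sizes by (intro divide_left_mono) auto
        also have "\<dots> = ?K / (2 * real N2) + 1"
          using sizes by (simp add: add_divide_distrib)
        finally show ?thesis .
      qed
      then have "c\<^sup>2 * d N2 \<le> c\<^sup>2 * (?K / (2 * real N2) + 1)"
        by (intro mult_left_mono) auto
      also have "\<dots> = ?K * (2 * c\<^sup>2 / (4 * real N2)) + c\<^sup>2"
        by (simp add: algebra_simps)
      also have "2 * c\<^sup>2 / (4 * real N2) \<le> real B / (4 * real N2)"
        using B(1) by (intro divide_right_mono) auto
      also have "real B / (4 * real N2) = 1 / (4 * real n)"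
        using B(2) by (simp add: N2_def)
      finally have "c\<^sup>2 * d N2 \<le> ?K * (1 / (4 * real n)) + c\<^sup>2"
        using \<open>0 \<le> ?K\<close> by (simp add: mult_left_mono)
      also have "c\<^sup>2 < ?K / real n * (3 / 4)"
      proof -
        define y where "y = ?K / real n"
        have "x \<le> 2 * y"
          unfolding y_def
          using k_sq \<open>0 < real n\<close> n_eq x(3) by (simp add: field_simps power3_eq_cube power4_eq_xxxx)
        then have "c\<^sup>2 < y * (3 / 4)"
          using x(2) \<open>1 \<le> c\<^sup>2\<close> by linarith
        then show ?thesis
          unfolding y_def .
      qed
      finally have "c\<^sup>2 * d N2 < ?K / real n"
        by simp
      also have "\<dots> \<le> d N1"
        unfolding d_def using n_split \<open>0 < real n\<close> by (simp add: divide_right_mono)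
      finally show ?thesis
        using c by (simp add: field_simps power2_eq_square)
    qed
    show False
    proof (rule confusion[OF k2 p pT conditions])
      fix S assume S: "S \<in> extensions M N1 {} {}"
      show "99 / 100 \<le> prob_within A (hard_graph k S) UNIV T"
      proof -
        have "num_verts (hard_graph k S) = n"
          using ext(4)[OF S] n_split by simp
        then obtain q where "q < 1 / (8 * real B) * x" "outputs_in_using A (hard_graph k S) UNIV q"
          using contra ext(3)[OF S] unfolding x_def by blast
        then obtain t where t: "real t < 1 / (8 * real B) * x" "99 / 100 \<le> prob_within A (hard_graph k S) UNIV t"
          unfolding outputs_in_using_def by force
        then have "t \<le> T"
          unfolding T_def by linarith
        then show ?thesis
          using t(2) prob_run_mono[of t T A "hard_graph k S" "[]" UNIV] unfolding prob_within_def by linarith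
      qed
      show "outputs_in A (hard_graph k S) {d N1 / c..c * d N1}"
        using ext(5)[OF S] .
    next
      fix S assume "S \<in> extensions M N2 {} {}"
      then show "outputs_in A (hard_graph k S) {d N2 / c..c * d N2}"
        by (rule ext(5))
    next
      show "{d N2 / c..c * d N2} \<inter> {d N1 / c..c * d N1} = {}"
        using separated by auto
    qed
  qed
  then show ?thesis
    using that[of "1 / (8 * real B)" "nat \<lceil>X ^ 3\<rceil>"] B(2) by simp
qed


section \<open>Matching bounds\<close>

text \<open>The two terms balance at d = n^(1/3); for larger d the quotient n / d is below
  n^(2/3).\<close>

lemma min_degree_root_le:
  fixes n d :: real
  assumes "1 \<le> d" "1 \<le> n"
  shows "min d (sqrt (n / d)) \<le> n powr (1 / 3)"
proof (cases "d \<le> n powr (1 / 3)")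
  case False
  have "n / d \<le> n / n powr (1 / 3)"
    using False assms by (intro divide_left_mono) auto
  also have "\<dots> = (n powr (1 / 3))\<^sup>2"
  proof -
    have "n = n powr (1 / 3) * n powr (1 / 3) * n powr (1 / 3)"
      using assms by (simp flip: powr_add)
    then show ?thesis
      using assms by (simp add: power2_eq_square divide_eq_eq)
  qed
  finally have "sqrt (n / d) \<le> n powr (1 / 3)"
    by (rule real_le_lsqrt[rotated]) simp
  then show ?thesis by simp
qed simp

text \<open>For \<eta> = \<epsilon> / 10 the constant is 10^9 * 1500 * 100.\<close>

lemma query_upper_bound:
  assumes \<epsilon>: "0 < \<epsilon>" "\<epsilon> < 1" and G: "input_graph G"
    and q: "150000000000000 * (1 / \<epsilon>\<^sup>2 * min (avg_deg G) (sqrt (real (num_verts G) / avg_deg G))) \<le> q"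
  shows "outputs_in_using (sampling_algorithm (decision (\<epsilon> / 10))) G (eps_approx \<epsilon> G) q"
  using sampling_algorithm_correct[OF G, of "\<epsilon> / 10" q] \<epsilon> q
  by (simp add: stop_level_def power_divide)

theorem theorem1p3:
  shows
    "(\<exists>(A :: real \<Rightarrow> algorithm) (C :: real) (k :: nat).
        \<forall>\<epsilon>. 0 < \<epsilon> \<and> \<epsilon> < 1 \<longrightarrow>
          uses_only (base_model \<union> {RandEdge}) (A \<epsilon>) \<and>
          (\<forall>G. input_graph G \<longrightarrow>
            outputs_in_using (A \<epsilon>) G (eps_approx \<epsilon> G)
              (C * log 2 (real (num_verts G)) ^ k *
                (1 / \<epsilon>\<^sup>2 * min (avg_deg G) (sqrt (real (num_verts G) / avg_deg G)))) \<and>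
            outputs_in_using (A \<epsilon>) G (eps_approx \<epsilon> G)
              (C * log 2 (real (num_verts G)) ^ k *
                (1 / \<epsilon>\<^sup>2 * real (num_verts G) powr (1 / 3)))))
     \<and>
     (\<forall>Q \<in> {base_model \<union> {RandEdge}, full_adjacency_model \<union> {RandEdge}}.
        \<forall>c::real. c \<ge> 1 \<longrightarrow>
          (\<exists>(\<kappa> :: real) (n\<^sub>0 :: nat). \<kappa> > 0 \<and>
            (\<forall>A. uses_only Q A \<and>
                 (\<forall>G. input_graph G \<longrightarrow> outputs_in A G (factor_approx c G)) \<longrightarrow>
              (\<forall>n\<ge>n\<^sub>0. \<exists>G. input_graph G \<and> num_verts G = n \<and>
                (\<forall>q. q < \<kappa> * real n powr (1 / 3) \<longrightarrow> \<not> outputs_in_using A G UNIV q)))))"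
proof (intro conjI ballI allI impI)
  show "\<exists>(A :: real \<Rightarrow> algorithm) (C :: real) (k :: nat).
        \<forall>\<epsilon>. 0 < \<epsilon> \<and> \<epsilon> < 1 \<longrightarrow>
          uses_only (base_model \<union> {RandEdge}) (A \<epsilon>) \<and>
          (\<forall>G. input_graph G \<longrightarrow>
            outputs_in_using (A \<epsilon>) G (eps_approx \<epsilon> G)
              (C * log 2 (real (num_verts G)) ^ k *
                (1 / \<epsilon>\<^sup>2 * min (avg_deg G) (sqrt (real (num_verts G) / avg_deg G)))) \<and>
            outputs_in_using (A \<epsilon>) G (eps_approx \<epsilon> G)
              (C * log 2 (real (num_verts G)) ^ k *
                (1 / \<epsilon>\<^sup>2 * real (num_verts G) powr (1 / 3))))"
  \<comment> \<open>The logarithm enters with exponent 0: the bound holds without polylogarithmic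
    factors.\<close>
  proof (intro exI[of _ "\<lambda>\<epsilon>. sampling_algorithm (decision (\<epsilon> / 10))"] exI[of _ "150000000000000 :: real"]
      exI[of _ "0 :: nat"] allI impI conjI uses_only_sampling_algorithm; elim conjE)
    fix \<epsilon> :: real and G assume "0 < \<epsilon>" "\<epsilon> < 1" "input_graph G"
    note bound = query_upper_bound[OF this]
    show "outputs_in_using (sampling_algorithm (decision (\<epsilon> / 10))) G (eps_approx \<epsilon> G)
        (150000000000000 * log 2 (real (num_verts G)) ^ 0 *
          (1 / \<epsilon>\<^sup>2 * min (avg_deg G) (sqrt (real (num_verts G) / avg_deg G))))"
      by (rule bound) simp
    have "1 / \<epsilon>\<^sup>2 * min (avg_deg G) (sqrt (real (num_verts G) / avg_deg G)) \<le>
        1 / \<epsilon>\<^sup>2 * real (num_verts G) powr (1 / 3)"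
      using n_m_pos[OF \<open>input_graph G\<close>] avg_deg_bounds[OF \<open>input_graph G\<close>]
      by (intro mult_left_mono min_degree_root_le) auto
    then show "outputs_in_using (sampling_algorithm (decision (\<epsilon> / 10))) G (eps_approx \<epsilon> G)
        (150000000000000 * log 2 (real (num_verts G)) ^ 0 *
          (1 / \<epsilon>\<^sup>2 * real (num_verts G) powr (1 / 3)))"
      by (intro bound) simp
  qed
next
  fix Q and c :: real assume "c \<ge> 1"
  obtain \<kappa> :: real and n\<^sub>0 :: nat where "\<kappa> > 0"
    and "\<And>A n. (\<And>G. input_graph G \<Longrightarrow> outputs_in A G (factor_approx c G)) \<Longrightarrow> n\<^sub>0 \<le> n \<Longrightarrow>
      \<exists>G. input_graph G \<and> num_verts G = n \<and>
        (\<forall>q. q < \<kappa> * real n powr (1 / 3) \<longrightarrow> \<not> outputs_in_using A G UNIV q)"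
    using query_lower_bound[OF \<open>c \<ge> 1\<close>] by blast
  then show "\<exists>(\<kappa> :: real) (n\<^sub>0 :: nat). \<kappa> > 0 \<and>
      (\<forall>A. uses_only Q A \<and> (\<forall>G. input_graph G \<longrightarrow> outputs_in A G (factor_approx c G)) \<longrightarrow>
        (\<forall>n\<ge>n\<^sub>0. \<exists>G. input_graph G \<and> num_verts G = n \<and>
          (\<forall>q. q < \<kappa> * real n powr (1 / 3) \<longrightarrow> \<not> outputs_in_using A G UNIV q)))"
    by (intro exI[of _ \<kappa>] exI[of _ n\<^sub>0]) blast
qed

end
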